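(* Let $N\ge1$ be an integer and suppose $a>\max\{0,2-N\}$. Let $u(t,x)$ and $v(t,x)$ be real-valued functions on $[0,\infty)\times\mathbb{R}^N$, each of which (written $g$ below) satisfies: (i) $g$ is continuous on $[0,\infty)\times\mathbb{R}^N$; (ii) $g$ is of class $C^1$ in $t$; (iii) $g$ is of class $C^2$ in $x$ on $\mathbb{R}^N\setminus\{0\}$; (iv) for any $T>0$ there exist $k>0$, $R>0$ and $C>0$ such that $g(t,x)\le C(1+|x|^{ka})$ for all $t\in[0,T]$ and $|x|>R$; (v) $g_t=\frac1a|x|^{2-a}\Delta g$ (for $x\neq0$). If $u(0,x)=v(0,x)$ for all $x\in\mathbb{R}^N$ and $u(t,0)=v(t,0)$ for all $t\ge0$, then $u(t,x)=v(t,x)$ for all $t\ge0$ and $x\in\mathbb{R}^N$.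
   Context: $\Delta$ is the Euclidean Laplacian in the variable $x\in\mathbb{R}^N$ and $g_t=\partial g/\partial t$ (one-sided at $t=0$). *)

theory Defs
  imports "HOL-Analysis.Analysis"
begin

definition partial_deriv :: "'n \<Rightarrow> (real ^ 'n \<Rightarrow> real) \<Rightarrow> real ^ 'n \<Rightarrow> real" where
  "partial_deriv i f x = deriv (\<lambda>h. f (x + h *\<^sub>R axis i 1)) 0"

definition has_partial_at :: "'n \<Rightarrow> (real ^ 'n \<Rightarrow> real) \<Rightarrow> real ^ 'n \<Rightarrow> bool" where
  "has_partial_at i f x \<longleftrightarrow> (\<lambda>h. f (x + h *\<^sub>R axis i 1)) field_differentiable (at 0)"

text \<open>Class \<open>C\<^sup>k\<close> on an open set: all iterated partial derivatives of order at most \<open>k\<close>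
  exist and are continuous there.\<close>

fun class_C :: "nat \<Rightarrow> (real ^ 'n) set \<Rightarrow> (real ^ 'n \<Rightarrow> real) \<Rightarrow> bool" where
  "class_C 0 S f \<longleftrightarrow> continuous_on S f"
| "class_C (Suc k) S f \<longleftrightarrow> continuous_on S f \<and>
     (\<forall>i. (\<forall>x\<in>S. has_partial_at i f x) \<and> class_C k S (partial_deriv i f))"

definition laplacian :: "(real ^ 'n \<Rightarrow> real) \<Rightarrow> real ^ 'n \<Rightarrow> real" where
  "laplacian f x = (\<Sum>i\<in>UNIV. partial_deriv i (partial_deriv i f) x)"

text \<open>A function on \<open>[0,\<infinity>) \<times> \<real>\<^sup>N\<close> is a total function \<open>g\<close> of which only the values \<open>g t x\<close>
  with \<open>t \<ge> 0\<close> matter. Differentiating within \<open>{0..}\<close> gives the one-sided derivative at \<open>t = 0\<close>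
  and the ordinary one at \<open>t > 0\<close>.\<close>

definition time_deriv :: "(real \<Rightarrow> real ^ 'n \<Rightarrow> real) \<Rightarrow> real \<Rightarrow> real ^ 'n \<Rightarrow> real" where
  "time_deriv g t x = vector_derivative (\<lambda>s. g s x) (at t within {0..})"

definition C1_in_time :: "(real \<Rightarrow> real ^ 'n \<Rightarrow> real) \<Rightarrow> bool" where
  "C1_in_time g \<longleftrightarrow> (\<forall>x. (\<lambda>s. g s x) differentiable_on {0..} \<and>
                         continuous_on {0..} (\<lambda>t. time_deriv g t x))"

text \<open>The growth condition bounds \<open>g\<close> from above only; the constants may depend on \<open>T\<close>.\<close>

definition growth_bound :: "real \<Rightarrow> (real \<Rightarrow> real ^ 'n \<Rightarrow> real) \<Rightarrow> bool" where
  "growth_bound a g \<longleftrightarrow> (\<forall>T>0. \<exists>k>0. \<exists>R>0. \<exists>C>0. \<forall>t\<in>{0..T}. \<forall>x.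
     norm x > R \<longrightarrow> g t x \<le> C * (1 + norm x powr (k * a)))"

definition a_heat_solution :: "real \<Rightarrow> (real \<Rightarrow> real ^ 'n \<Rightarrow> real) \<Rightarrow> bool" where
  "a_heat_solution a g \<longleftrightarrow>
     continuous_on ({0..} \<times> UNIV) (\<lambda>(t, x). g t x) \<and>
     C1_in_time g \<and>
     (\<forall>t\<ge>0. class_C 2 (UNIV - {0}) (g t)) \<and>
     growth_bound a g \<and>
     (\<forall>t\<ge>0. \<forall>x. x \<noteq> 0 \<longrightarrow>
        time_deriv g t x = 1 / a * norm x powr (2 - a) * laplacian (g t) x)"

end

theory Submission
  imports Defs
begin

text \<open>The operator \<open>|x|\<^bsup>2-a\<^esup> \<Delta> / a\<close> has explicit positive supersolutions growing like \<open>exp (\<kappa> |x|\<^sup>a)\<close>.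
  Subtracting \<open>u\<close> and \<open>v\<close> from such a function \<open>P\<close> turns the one-sided growth condition into a
  positivity condition as in Widder's theorem: \<open>S = 2P - u - v\<close> is a nonnegative supersolution
  dominating a smoothed positive part \<open>G\<close> of \<open>u - v - \<delta>\<close>, which is a nonnegative subsolution vanishing
  initially and near the origin.

  Positivity limits the growth of \<open>S\<close>: a compactly supported subsolution travelling from the
  shell \<open>y \<le> |x|\<^bsup>a/2\<^esup> \<le> y + 1\<close> to the unit sphere shows that the time average of \<open>S\<close> is at most
  \<open>exp (C y\<^sup>2)\<close> at some point of that shell, and on a whole sphere if \<open>S\<close> is first made almost
  radial by averaging over rotations. The same average of \<open>G\<close> is then dominated, on arbitrarily
  large spheres, by a small multiple of an exponential supersolution, hence vanishes.

  The hypotheses give only separate continuity of the derivatives, so nothing can be differentiated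
  under an integral sign. All averages are therefore finite sums, which inherit the differential
  inequality pointwise, and the only analytic tool is the maximum principle.\<close>

text \<open>The growth condition bounds \<open>u\<close> and \<open>v\<close> from above only, so
  \<open>u - v\<close> may be huge wherever \<open>v\<close> is very negative: it cannot be compared
  with a barrier directly, and the bound on large spheres has to come from the sign of
  \<open>S\<close>. In the variable \<open>|x| powr (a / 2)\<close> the second order coefficient is
  the constant \<open>a / 4\<close>; transport over a distance \<open>y\<close> in a fixed time
  therefore costs a Gaussian factor \<open>exp (C * y\<^sup>2)\<close>, the scale of the barriers
  \<open>exp (\<kappa> * |x| powr a)\<close>. The bump only finds one good point, which could change
  with time. Summing \<open>S\<close> over a forward time window beforehand yields one sphere good
  for the whole window, and there the backward sums of \<open>G\<close>, which vanishes at negative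
  times, are controlled at all later times of the window. A barrier with rate above \<open>C\<close>
  is a supersolution only for a time of order \<open>1 / (a * (C + 1))\<close>, hence the advance in
  time steps of fixed length. The equation says nothing at the origin; agreement of \<open>u\<close>
  and \<open>v\<close> there, together with the subtraction of \<delta>, makes \<open>G\<close>
  vanish near it.\<close>

section \<open>Pointwise Laplacians and the parabolic maximum principle\<close>

text \<open>The gradient \<open>\<gamma>\<close> is kept beside the trace because the chain rule
  needs its square. The gradient field must exist near \<open>x\<close> but be differentiable only
  at \<open>x\<close>: enough for the second derivative test, and it passes to sums, compositions
  and rotations without continuity of second derivatives.\<close>

definition has_lap :: "('a::euclidean_space \<Rightarrow> real) \<Rightarrow> 'a \<Rightarrow> real \<Rightarrow> 'a \<Rightarrow> bool" where
  "has_lap f \<gamma> l x \<longleftrightarrow> (\<exists>g A. (\<forall>\<^sub>F y in nhds x. (f has_derivative (\<lambda>v. g y \<bullet> v)) (at y)) \<and>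
     (g has_derivative A) (at x) \<and> g x = \<gamma> \<and> l = (\<Sum>i\<in>Basis. A i \<bullet> i))"

lemma has_lapI:
  assumes "\<forall>\<^sub>F y in nhds x. (f has_derivative (\<lambda>v. g y \<bullet> v)) (at y)"
    "(g has_derivative A) (at x)" "g x = \<gamma>" "l = (\<Sum>i\<in>Basis. A i \<bullet> i)"
  shows "has_lap f \<gamma> l x"
  using assms unfolding has_lap_def by blast

lemma has_lapE:
  assumes "has_lap f \<gamma> l x"
  obtains g A where "\<forall>\<^sub>F y in nhds x. (f has_derivative (\<lambda>v. g y \<bullet> v)) (at y)"
    "(g has_derivative A) (at x)" "g x = \<gamma>" "l = (\<Sum>i\<in>Basis. A i \<bullet> i)"
  using assms unfolding has_lap_def by blast

lemma has_lap_const: "has_lap (\<lambda>_. k) 0 0 x"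
  by (rule has_lapI[where g="\<lambda>_. 0" and A="\<lambda>_. 0"]) auto

lemma has_lap_add:
  assumes "has_lap f \<gamma> l x" "has_lap f' \<gamma>' l' x"
  shows "has_lap (\<lambda>y. f y + f' y) (\<gamma> + \<gamma>') (l + l') x"
proof -
  obtain g A where 1: "\<forall>\<^sub>F y in nhds x. (f has_derivative (\<lambda>v. g y \<bullet> v)) (at y)"
    "(g has_derivative A) (at x)" "g x = \<gamma>" "l = (\<Sum>i\<in>Basis. A i \<bullet> i)"
    by (rule has_lapE[OF assms(1)])
  obtain g' A' where 2: "\<forall>\<^sub>F y in nhds x. (f' has_derivative (\<lambda>v. g' y \<bullet> v)) (at y)"
    "(g' has_derivative A') (at x)" "g' x = \<gamma>'" "l' = (\<Sum>i\<in>Basis. A' i \<bullet> i)"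
    by (rule has_lapE[OF assms(2)])
  show ?thesis
  proof (rule has_lapI[where g="\<lambda>y. g y + g' y" and A="\<lambda>v. A v + A' v"])
    show "\<forall>\<^sub>F y in nhds x. ((\<lambda>y. f y + f' y) has_derivative (\<lambda>v. (g y + g' y) \<bullet> v)) (at y)"
      using 1(1) 2(1)
      by eventually_elim (auto simp: inner_add_left intro: has_derivative_add)
  qed (use 1 2 in \<open>auto simp: inner_add_left sum.distrib intro: has_derivative_add\<close>)
qed

lemma has_lap_chain:
  fixes H :: "real \<Rightarrow> real"
  assumes "has_lap f \<gamma> l x"
    and H: "\<And>z. (H has_real_derivative H' z) (at z)"
    and H': "\<And>z. (H' has_real_derivative H'' z) (at z)"
  shows "has_lap (\<lambda>y. H (f y)) (H' (f x) *\<^sub>R \<gamma>) (H'' (f x) * (\<gamma> \<bullet> \<gamma>) + H' (f x) * l) x"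
proof -
  obtain g A where 1: "\<forall>\<^sub>F y in nhds x. (f has_derivative (\<lambda>v. g y \<bullet> v)) (at y)"
    "(g has_derivative A) (at x)" "g x = \<gamma>" "l = (\<Sum>i\<in>Basis. A i \<bullet> i)"
    by (rule has_lapE[OF assms(1)])
  have fx: "(f has_derivative (\<lambda>v. \<gamma> \<bullet> v)) (at x)"
    using eventually_nhds_x_imp_x[OF 1(1)] 1(3) by simp
  have comp: "((\<lambda>y. K (f y)) has_derivative (\<lambda>v. k * (h \<bullet> v))) (at y)"
    if "(K has_real_derivative k) (at (f y))" "(f has_derivative (\<lambda>v. h \<bullet> v)) (at y)" for K k h y
    using has_derivative_compose[OF that(2) that(1)[unfolded has_field_derivative_def]] .
  show ?thesis
  proof (rule has_lapI[where g="\<lambda>y. H' (f y) *\<^sub>R g y" and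
        A="\<lambda>v. H' (f x) *\<^sub>R A v + (H'' (f x) * (\<gamma> \<bullet> v)) *\<^sub>R g x"])
    show "\<forall>\<^sub>F y in nhds x. ((\<lambda>y. H (f y)) has_derivative (\<lambda>v. (H' (f y) *\<^sub>R g y) \<bullet> v)) (at y)"
      using 1(1) by eventually_elim (use comp[OF H] in simp)
    show "((\<lambda>y. H' (f y) *\<^sub>R g y) has_derivative (\<lambda>v. H' (f x) *\<^sub>R A v + (H'' (f x) * (\<gamma> \<bullet> v)) *\<^sub>R g x)) (at x)"
      by (rule has_derivative_scaleR[OF comp[OF H' fx] 1(2)])
    show "H'' (f x) * (\<gamma> \<bullet> \<gamma>) + H' (f x) * l =
      (\<Sum>i\<in>Basis. (H' (f x) *\<^sub>R A i + (H'' (f x) * (\<gamma> \<bullet> i)) *\<^sub>R g x) \<bullet> i)"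
      using 1(3,4) euclidean_inner[of \<gamma> \<gamma>]
      by (simp add: inner_add_left sum.distrib sum_distrib_left mult.assoc)
  qed (use 1 in simp)
qed

lemma has_lap_cmult:
  assumes "has_lap f \<gamma> l x"
  shows "has_lap (\<lambda>y. k * f y) (k *\<^sub>R \<gamma>) (k * l) x"
  using has_lap_chain[OF assms, of "\<lambda>z. k * z" "\<lambda>_. k" "\<lambda>_. 0"]
  by (auto intro!: derivative_eq_intros)

text \<open>\<open>A z \<bullet> z\<close> is a quadratic form in the coordinates of
  \<open>z\<close>; summing it over the orthonormal frame \<open>R i\<close> leaves only the
  orthogonality relations \<open>key\<close> of the coefficients.\<close>

lemma trace_orthogonal:
  fixes A R :: "'a::euclidean_space \<Rightarrow> 'a"
  assumes R: "orthogonal_transformation R" and A: "linear A"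
  shows "(\<Sum>i\<in>Basis. A (R i) \<bullet> R i) = (\<Sum>i\<in>Basis. A i \<bullet> i)"
proof -
  have R': "orthogonal_transformation (inv R)"
    using R by (rule orthogonal_transformation_inv)
  have adj: "R i \<bullet> j = i \<bullet> inv R j" for i j
    using R by (metis orthogonal_transformation_def orthogonal_transformation_surj surj_f_inv_f)
  have key: "(\<Sum>i\<in>Basis. (R i \<bullet> j) * (R i \<bullet> k)) = j \<bullet> k" for j k
  proof -
    have "(\<Sum>i\<in>Basis. (R i \<bullet> j) * (R i \<bullet> k)) = inv R j \<bullet> inv R k"
      unfolding adj by (simp add: euclidean_inner[of "inv R j" "inv R k"] inner_commute)
    then show ?thesis using R' by (simp add: orthogonal_transformation_def)
  qed
  have exp: "A z \<bullet> z = (\<Sum>j\<in>Basis. \<Sum>k\<in>Basis. (A j \<bullet> k) * ((z \<bullet> j) * (z \<bullet> k)))" for z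
  proof -
    have "A z = (\<Sum>j\<in>Basis. (z \<bullet> j) *\<^sub>R A j)"
      using arg_cong[OF euclidean_representation[of z, symmetric], of A] A
      by (simp add: linear_sum linear_cmul)
    then have Az: "A z \<bullet> k = (\<Sum>j\<in>Basis. (z \<bullet> j) * (A j \<bullet> k))" for k
      by (simp add: inner_sum_left)
    have "A z \<bullet> z = (\<Sum>k\<in>Basis. (A z \<bullet> k) * (z \<bullet> k))" by (rule euclidean_inner)
    also have "\<dots> = (\<Sum>k\<in>Basis. \<Sum>j\<in>Basis. (A j \<bullet> k) * ((z \<bullet> j) * (z \<bullet> k)))"
      unfolding Az sum_distrib_right by (intro sum.cong refl) (simp only: mult_ac)
    also have "\<dots> = (\<Sum>j\<in>Basis. \<Sum>k\<in>Basis. (A j \<bullet> k) * ((z \<bullet> j) * (z \<bullet> k)))"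
      by (rule sum.swap)
    finally show ?thesis .
  qed
  have "(\<Sum>i\<in>Basis. A (R i) \<bullet> R i) =
      (\<Sum>j\<in>Basis. \<Sum>k\<in>Basis. (A j \<bullet> k) * (\<Sum>i\<in>Basis. (R i \<bullet> j) * (R i \<bullet> k)))"
    unfolding exp sum_distrib_left
    by (subst sum.swap) (intro sum.cong refl sum.swap)
  also have "\<dots> = (\<Sum>j\<in>Basis. A j \<bullet> j)"
    unfolding key by (intro sum.cong refl) (simp add: inner_Basis if_distrib cong: if_cong)
  finally show ?thesis .
qed

text \<open>The gradient of \<open>f \<circ> R\<close> at \<open>y\<close> is the adjoint
  \<open>inv R\<close> applied to the gradient of \<open>f\<close> at \<open>R y\<close>, so the
  Hessian is conjugated by \<open>R\<close> and keeps its trace.\<close>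

lemma has_lap_orthogonal:
  fixes f :: "'a::euclidean_space \<Rightarrow> real" and R :: "'a \<Rightarrow> 'a"
  assumes "has_lap f \<gamma> l (R x)" and R: "orthogonal_transformation R"
  shows "\<exists>\<gamma>'. has_lap (\<lambda>y. f (R y)) \<gamma>' l x"
proof -
  obtain g A where 1: "\<forall>\<^sub>F y in nhds (R x). (f has_derivative (\<lambda>v. g y \<bullet> v)) (at y)"
    "(g has_derivative A) (at (R x))" "g (R x) = \<gamma>" "l = (\<Sum>i\<in>Basis. A i \<bullet> i)"
    by (rule has_lapE[OF assms(1)])
  have lR: "bounded_linear R" "bounded_linear (inv R)"
    using R orthogonal_transformation_inv[OF R] orthogonal_transformation_linear linear_conv_bounded_linear by blast+
  have adj: "i \<bullet> R j = inv R i \<bullet> j" for i j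
    using R by (metis orthogonal_transformation_def orthogonal_transformation_surj surj_f_inv_f)
  have dR: "(R has_derivative R) (at y)" for y
    by (rule bounded_linear_imp_has_derivative[OF lR(1)])
  have "has_lap (\<lambda>y. f (R y)) (inv R \<gamma>) l x"
  proof (rule has_lapI[where g="\<lambda>y. inv R (g (R y))" and A="\<lambda>v. inv R (A (R v))"])
    have "(R \<longlongrightarrow> R x) (nhds x)"
      using linear_continuous_at[OF lR(1), of x]
      by (simp add: isCont_def tendsto_at_iff_tendsto_nhds)
    from eventually_compose_filterlim[OF 1(1) this]
    show "\<forall>\<^sub>F y in nhds x. ((\<lambda>y. f (R y)) has_derivative (\<lambda>v. inv R (g (R y)) \<bullet> v)) (at y)"
    proof eventually_elim
      case (elim y)
      show ?case using has_derivative_compose[OF dR elim] by (simp add: adj[symmetric])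
    qed
    show "((\<lambda>y. inv R (g (R y))) has_derivative (\<lambda>v. inv R (A (R v)))) (at x)"
      by (rule bounded_linear.has_derivative[OF lR(2)]) (rule has_derivative_compose[OF dR 1(2)])
    show "l = (\<Sum>i\<in>Basis. inv R (A (R i)) \<bullet> i)"
      using trace_orthogonal[OF R, of A] has_derivative_linear[OF 1(2)] 1(4) by (simp add: adj)
  qed (simp add: 1)
  then show ?thesis ..
qed

text \<open>Were a diagonal entry \<open>A i \<bullet> i\<close> positive, the slope
  \<open>q\<close> along \<open>i\<close>, which is zero at the maximum, would be positive just
  after it, and the mean value theorem would give a larger value of \<open>f\<close>.\<close>

lemma has_lap_local_max:
  fixes f :: "'a::euclidean_space \<Rightarrow> real"
  assumes "has_lap f \<gamma> l x" and max: "\<forall>\<^sub>F y in nhds x. f y \<le> f x"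
  shows "l \<le> 0"
proof -
  obtain g A where 1: "\<forall>\<^sub>F y in nhds x. (f has_derivative (\<lambda>v. g y \<bullet> v)) (at y)"
    "(g has_derivative A) (at x)" "g x = \<gamma>" "l = (\<Sum>i\<in>Basis. A i \<bullet> i)"
    by (rule has_lapE[OF assms(1)])
  have "A i \<bullet> i \<le> 0" for i
  proof (rule ccontr)
    assume neg: "\<not> A i \<bullet> i \<le> 0"
    define p where "p s = f (x + s *\<^sub>R i)" for s
    define q where "q s = g (x + s *\<^sub>R i) \<bullet> i" for s
    have dl: "((\<lambda>s. x + s *\<^sub>R i) has_derivative (\<lambda>h. h *\<^sub>R i)) (at s)" for s :: real
      by (auto intro!: derivative_eq_intros)
    have "((\<lambda>s. x + s *\<^sub>R i) \<longlongrightarrow> x + 0 *\<^sub>R i) (nhds 0)"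
      by (intro tendsto_intros) (simp add: filterlim_ident)
    then have lim: "filterlim (\<lambda>s. x + s *\<^sub>R i) (nhds x) (nhds 0)" by simp
    have "\<forall>\<^sub>F s in nhds 0. (p has_real_derivative q s) (at s) \<and> p s \<le> p 0"
      using eventually_compose_filterlim[OF 1(1) lim] eventually_compose_filterlim[OF max lim]
    proof eventually_elim
      case (elim s)
      have "(p has_derivative (\<lambda>h. g (x + s *\<^sub>R i) \<bullet> (h *\<^sub>R i))) (at s)"
        unfolding p_def by (rule has_derivative_compose[OF dl elim(1)])
      then show ?case using elim(2)
        by (auto simp: has_field_derivative_def q_def p_def mult_commute_abs)
    qed
    then obtain d where d: "d > 0" "\<And>s. \<bar>s\<bar> < d \<Longrightarrow> (p has_real_derivative q s) (at s) \<and> p s \<le> p 0"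
      unfolding eventually_nhds_metric by (auto simp: dist_real_def)
    have q0: "q 0 = 0"
      by (rule DERIV_local_max[of p "q 0" 0 d]) (use d in auto)
    have "((\<lambda>s. g (x + s *\<^sub>R i)) has_derivative (\<lambda>h. A (h *\<^sub>R i))) (at 0)"
      by (rule has_derivative_compose[OF dl]) (use 1(2) in simp)
    then have "(q has_derivative (\<lambda>h. A (h *\<^sub>R i) \<bullet> i)) (at 0)"
      unfolding q_def by (rule has_derivative_inner_left)
    then have "(q has_real_derivative A i \<bullet> i) (at 0)"
      using linear_cmul[OF has_derivative_linear[OF 1(2)]]
      by (simp add: has_field_derivative_def mult_commute_abs)
    from DERIV_pos_inc_right[OF this] neg obtain e where e: "e > 0" "\<And>h. 0 < h \<Longrightarrow> h < e \<Longrightarrow> q h > 0"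
      using q0 by auto
    define s where "s = min d e / 2"
    have s: "0 < s" "s < d" "s < e" using d(1) e(1) by (auto simp: s_def)
    have "\<exists>z. 0 < z \<and> z < s \<and> p s - p 0 = (s - 0) * q z"
      by (rule MVT2) (use s d in auto)
    then obtain z where z: "0 < z" "z < s" "p s - p 0 = (s - 0) * q z" by blast
    moreover have "q z > 0" using e(2) z s by simp
    ultimately have "p s > p 0" using s by (smt (verit) mult_pos_pos)
    then show False using d(2)[of s] s by simp
  qed
  then show ?thesis unfolding 1(4) by (rule sum_nonpos)
qed

text \<open>Subcaloric at one point. The derivatives are quantified existentially, so a subsolution
  is certified by exhibiting them; supersolutions are handled as negatives of subsolutions.\<close>

definition subcal :: "('a::euclidean_space \<Rightarrow> real) \<Rightarrow> (real \<Rightarrow> 'a \<Rightarrow> real) \<Rightarrow> real \<Rightarrow> 'a \<Rightarrow> bool" where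
  "subcal c f t x \<longleftrightarrow> (\<exists>D \<gamma> l. ((\<lambda>s. f s x) has_real_derivative D) (at t) \<and> has_lap (f t) \<gamma> l x \<and> D \<le> c x * l)"

lemma subcal_add:
  assumes "subcal c f t x" "subcal c g t x"
  shows "subcal c (\<lambda>t x. f t x + g t x) t x"
proof -
  obtain D \<gamma> l where 1: "((\<lambda>s. f s x) has_real_derivative D) (at t)" "has_lap (f t) \<gamma> l x" "D \<le> c x * l"
    using assms(1) unfolding subcal_def by blast
  obtain D' \<gamma>' l' where 2: "((\<lambda>s. g s x) has_real_derivative D') (at t)" "has_lap (g t) \<gamma>' l' x" "D' \<le> c x * l'"
    using assms(2) unfolding subcal_def by blast
  have "D + D' \<le> c x * (l + l')" using 1(3) 2(3) by (simp add: distrib_left)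
  then show ?thesis unfolding subcal_def
    using DERIV_add[OF 1(1) 2(1)] has_lap_add[OF 1(2) 2(2)] by blast
qed

lemma subcal_cmult:
  assumes "subcal c f t x" "k \<ge> 0"
  shows "subcal c (\<lambda>t x. k * f t x) t x"
proof -
  obtain D \<gamma> l where 1: "((\<lambda>s. f s x) has_real_derivative D) (at t)" "has_lap (f t) \<gamma> l x" "D \<le> c x * l"
    using assms(1) unfolding subcal_def by blast
  have "k * D \<le> c x * (k * l)" using mult_left_mono[OF 1(3) assms(2)] by (simp add: mult_ac)
  then show ?thesis unfolding subcal_def
    using DERIV_cmult[OF 1(1)] has_lap_cmult[OF 1(2)] by blast
qed

lemma subcal_const: "subcal c (\<lambda>t x. k) t x"
  unfolding subcal_def using has_lap_const by (intro exI[of _ 0] exI conjI) auto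

lemma subcal_sum:
  assumes "\<And>i. i \<in> I \<Longrightarrow> subcal c (f i) t x"
  shows "subcal c (\<lambda>t x. \<Sum>i\<in>I. f i t x) t x"
  using assms
proof (induction I rule: infinite_finite_induct)
  case (insert i I)
  then show ?case using subcal_add[of c "f i" t x] by simp
qed (simp_all add: subcal_const)

lemma subcal_sum_list:
  assumes "\<And>i. i \<in> set I \<Longrightarrow> subcal c (f i) t x"
  shows "subcal c (\<lambda>t x. \<Sum>i\<leftarrow>I. f i t x) t x"
  using assms
proof (induction I)
  case (Cons i I)
  then show ?case using subcal_add[of c "f i" t x] by simp
qed (simp add: subcal_const)

lemma subcal_shift:
  assumes "subcal c f (t + h) x"
  shows "subcal c (\<lambda>t. f (t + h)) t x"
  using assms unfolding subcal_def by (simp add: DERIV_shift)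

lemma subcal_orthogonal:
  fixes R :: "'a::euclidean_space \<Rightarrow> 'a"
  assumes "subcal c f t (R x)" "orthogonal_transformation R" "c (R x) = c x"
  shows "subcal c (\<lambda>t x. f t (R x)) t x"
  using assms has_lap_orthogonal[of "f t" _ _ R x] unfolding subcal_def by metis

text \<open>Positivity is what gets refuted, so the differential inequality and the interior
  condition are demanded only where \<open>F\<close> is positive; the interior condition thus
  carries the lateral boundary values. Subtracting a small multiple of the elapsed time makes the
  inequality strict at a maximum.\<close>

lemma parabolic_maximum_principle:
  fixes F :: "real \<Rightarrow> 'a::euclidean_space \<Rightarrow> real"
  assumes "compact K" and cont: "continuous_on ({t0..t1} \<times> K) (\<lambda>p. F (fst p) (snd p))"
    and init: "\<And>x. x \<in> K \<Longrightarrow> F t0 x \<le> 0"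
    and pos: "\<And>t x. t0 < t \<Longrightarrow> t \<le> t1 \<Longrightarrow> x \<in> K \<Longrightarrow> F t x > 0 \<Longrightarrow>
      x \<in> interior K \<and> subcal c F t x \<and> c x \<ge> 0"
    and tx: "t \<in> {t0..t1}" "x \<in> K"
  shows "F t x \<le> 0"
proof (rule ccontr)
  assume "\<not> F t x \<le> 0"
  \<comment> \<open>The tilt uses up at most half of the positive value \<open>F t x\<close>; the
    \<open>+ 1\<close> keeps the denominator positive when \<open>t0 = t1\<close>.\<close>
  define \<epsilon> where "\<epsilon> = F t x / (2 * (t1 - t0 + 1))"
  have len: "t1 - t0 + 1 > 0" using tx(1) by auto
  have \<epsilon>: "\<epsilon> > 0" using \<open>\<not> F t x \<le> 0\<close> len by (simp add: \<epsilon>_def)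
  have "F t x = 2 * \<epsilon> * (t1 - t0 + 1)" using len by (simp add: \<epsilon>_def field_simps)
  moreover have "\<epsilon> * (t - t0) \<le> \<epsilon> * (t1 - t0 + 1)" using \<epsilon> tx(1) by (intro mult_left_mono) auto
  moreover have "\<epsilon> * (t1 - t0 + 1) > 0" using \<epsilon> len by simp
  ultimately have big: "F t x - \<epsilon> * (t - t0) > 0" by linarith
  have cK: "compact ({t0..t1} \<times> K)" using assms(1) by (intro compact_Times) auto
  have "\<exists>p\<in>{t0..t1} \<times> K. \<forall>q\<in>{t0..t1} \<times> K.
      F (fst q) (snd q) - \<epsilon> * (fst q - t0) \<le> F (fst p) (snd p) - \<epsilon> * (fst p - t0)"
    by (rule continuous_attains_sup[OF cK]) (use tx cont in \<open>auto intro!: continuous_intros\<close>)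
  then obtain s y where sy: "s \<in> {t0..t1}" "y \<in> K"
    and mx: "\<And>s' y'. s' \<in> {t0..t1} \<Longrightarrow> y' \<in> K \<Longrightarrow> F s' y' - \<epsilon> * (s' - t0) \<le> F s y - \<epsilon> * (s - t0)"
    by auto
  have pos': "F s y - \<epsilon> * (s - t0) > 0" using mx[OF tx] big by linarith
  have "s \<noteq> t0" using init[OF sy(2)] pos' by auto
  then have s: "t0 < s" "s \<le> t1" using sy(1) by auto
  have "\<epsilon> * (s - t0) > 0" using \<epsilon> s by simp
  then have "F s y > 0" using pos' by linarith
  from pos[OF s sy(2) this] obtain D \<gamma> l where
    int: "y \<in> interior K" and D: "((\<lambda>s. F s y) has_real_derivative D) (at s)"
    and l: "has_lap (F s) \<gamma> l y" and ineq: "D \<le> c y * l" and c: "c y \<ge> 0"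
    unfolding subcal_def by blast
  have "l \<le> 0"
  proof (rule has_lap_local_max[OF l])
    have "\<forall>\<^sub>F z in nhds y. z \<in> interior K" using int by (simp add: eventually_nhds_in_open)
    then show "\<forall>\<^sub>F z in nhds y. F s z \<le> F s y"
      by eventually_elim (use mx[of s] sy(1) interior_subset in fastforce)
  qed
  then have "D \<le> 0" using ineq c by (smt (verit) mult_nonneg_nonpos)
  have "((\<lambda>s. F s y - \<epsilon> * (s - t0)) has_real_derivative D - \<epsilon>) (at s)"
    using D by (auto intro!: derivative_eq_intros)
  \<comment> \<open>Only earlier times are compared, so a maximum at the final time
    \<open>t1\<close> is covered.\<close>
  from DERIV_neg_dec_left[OF this] \<open>D \<le> 0\<close> \<epsilon> obtain d where
    d: "d > 0" "\<And>h. 0 < h \<Longrightarrow> h < d \<Longrightarrow> F s y - \<epsilon> * (s - t0) < F (s - h) y - \<epsilon> * (s - h - t0)"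
    by auto
  define h where "h = min (d / 2) (s - t0)"
  have "0 < h" "h < d" "s - h \<in> {t0..t1}" using d(1) s by (auto simp: h_def min_def)
  with d(2)[of h] mx[of "s - h" y] sy(2) show False by simp
qed

section \<open>Classical partial derivatives and the pointwise Laplacian\<close>

lemma has_partial_at_DERIV:
  assumes "has_partial_at i f (p + s *\<^sub>R axis i 1)"
  shows "((\<lambda>h. f (p + h *\<^sub>R axis i 1)) has_real_derivative partial_deriv i f (p + s *\<^sub>R axis i 1)) (at s)"
proof -
  have "((\<lambda>h. f ((p + s *\<^sub>R axis i 1) + h *\<^sub>R axis i 1)) has_real_derivative
      partial_deriv i f (p + s *\<^sub>R axis i 1)) (at 0)"
    using assms DERIV_deriv_iff_field_differentiable
    unfolding has_partial_at_def partial_deriv_def by blast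
  then have "((\<lambda>h. f (p + (h + s) *\<^sub>R axis i 1)) has_real_derivative
      partial_deriv i f (p + s *\<^sub>R axis i 1)) (at 0)"
    by (simp add: algebra_simps)
  then show ?thesis
    using DERIV_shift[of "\<lambda>h. f (p + h *\<^sub>R axis i 1)" _ 0 s] by simp
qed

text \<open>The increment is built one coordinate at a time; by continuity of the partial
  derivatives, the mean value theorem on each leg costs at most \<epsilon> times the increment of
  that coordinate.\<close>

lemma has_derivative_of_continuous_partials:
  fixes f :: "real ^ 'n \<Rightarrow> real"
  assumes S: "open S" "x \<in> S"
    and part: "\<And>i y. y \<in> S \<Longrightarrow> has_partial_at i f y"
    and cont: "\<And>i. continuous_on S (partial_deriv i f)"
  shows "(f has_derivative (\<lambda>v. \<Sum>i\<in>UNIV. v $ i * partial_deriv i f x)) (at x)"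
  unfolding has_derivative_at_alt
proof (intro conjI allI impI)
  show "bounded_linear (\<lambda>v. \<Sum>i\<in>UNIV. v $ i * partial_deriv i f x)"
    by (intro bounded_linear_sum bounded_linear_mult_const bounded_linear_vec_nth)
  fix e :: real assume e: "e > 0"
  define \<epsilon> where "\<epsilon> = e / real CARD('n)"
  have \<epsilon>: "\<epsilon> > 0" using e by (simp add: \<epsilon>_def)
  have "\<forall>\<^sub>F y in nhds x. \<forall>i. y \<in> S \<and> dist (partial_deriv i f y) (partial_deriv i f x) < \<epsilon>"
  proof (rule eventually_all_finite, rule eventually_conj)
    fix i
    show "\<forall>\<^sub>F y in nhds x. y \<in> S" using S by (simp add: eventually_nhds_in_open)
    have "(partial_deriv i f \<longlongrightarrow> partial_deriv i f x) (nhds x)"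
      using cont[of i] S by (simp add: continuous_on_eq_continuous_at isCont_def tendsto_at_iff_tendsto_nhds)
    then show "\<forall>\<^sub>F y in nhds x. dist (partial_deriv i f y) (partial_deriv i f x) < \<epsilon>"
      using \<epsilon> by (rule tendstoD)
  qed
  then obtain d where d: "d > 0" and
    dS: "\<And>y. dist y x < d \<Longrightarrow> y \<in> S" and
    dd: "\<And>y i. dist y x < d \<Longrightarrow> dist (partial_deriv i f y) (partial_deriv i f x) < \<epsilon>"
    unfolding eventually_nhds_metric by blast
  have main: "\<bar>f (x + (\<Sum>i\<in>I. v $ i *\<^sub>R axis i 1)) - f x - (\<Sum>i\<in>I. v $ i * partial_deriv i f x)\<bar>
      \<le> (\<Sum>i\<in>I. \<epsilon> * \<bar>v $ i\<bar>)" if v: "norm v < d" for v and I :: "'n set"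
  proof (induction I rule: infinite_finite_induct)
    case (insert j I)
    define p where "p = x + (\<Sum>i\<in>I. v $ i *\<^sub>R axis i 1)"
    define h where "h s = f (p + s *\<^sub>R axis j 1) - s * partial_deriv j f x" for s
    define w where "w = (\<Sum>i\<in>I. v $ i *\<^sub>R axis i (1::real))"
    have comp: "w $ k = (if k \<in> I then v $ k else 0)" for k
      using insert(1) by (simp add: w_def axis_def if_distrib sum.delta cong: if_cong)
    \<comment> \<open>The leg stays in the ball because its displacement from \<open>x\<close> is
      componentwise no larger than \<open>v\<close>.\<close>
    have near: "dist (p + s *\<^sub>R axis j 1) x < d" if "s \<in> closed_segment 0 (v $ j)" for s
    proof -
      have "\<bar>s\<bar> \<le> \<bar>v $ j\<bar>" using that by (auto simp: closed_segment_eq_real_ivl split: if_splits)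
      then have "norm (w + s *\<^sub>R axis j 1) \<le> norm v"
        by (intro norm_le_componentwise_cart) (use insert(2) in \<open>auto simp: comp axis_def\<close>)
      then show ?thesis using v by (simp add: p_def w_def dist_norm add.assoc)
    qed
    have "norm (h (v $ j) - h 0) \<le> \<epsilon> * norm (v $ j - 0)"
    proof (rule field_differentiable_bound[where S="closed_segment 0 (v $ j)"])
      fix s assume s: "s \<in> closed_segment 0 (v $ j)"
      show "(h has_real_derivative partial_deriv j f (p + s *\<^sub>R axis j 1) - partial_deriv j f x)
          (at s within closed_segment 0 (v $ j))"
        unfolding h_def
        using has_partial_at_DERIV[OF part[OF dS[OF near[OF s]]]]
        by (auto intro!: derivative_eq_intros dest: has_field_derivative_at_within)
      show "norm (partial_deriv j f (p + s *\<^sub>R axis j 1) - partial_deriv j f x) \<le> \<epsilon>"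
        using dd[OF near[OF s], of j] by (simp add: dist_norm)
    qed auto
    then have "\<bar>f (p + v $ j *\<^sub>R axis j 1) - f p - v $ j * partial_deriv j f x\<bar> \<le> \<epsilon> * \<bar>v $ j\<bar>"
      by (simp add: h_def)
    moreover have "p + v $ j *\<^sub>R axis j 1 = x + (\<Sum>i\<in>insert j I. v $ i *\<^sub>R axis i 1)"
      using insert(1,2) by (simp add: p_def algebra_simps)
    moreover have "(\<Sum>i\<in>insert j I. v $ i * partial_deriv i f x) =
        v $ j * partial_deriv j f x + (\<Sum>i\<in>I. v $ i * partial_deriv i f x)"
      "(\<Sum>i\<in>insert j I. \<epsilon> * \<bar>v $ i\<bar>) = \<epsilon> * \<bar>v $ j\<bar> + (\<Sum>i\<in>I. \<epsilon> * \<bar>v $ i\<bar>)"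
      using insert(1,2) by auto
    moreover from calculation(2)
    have "f (x + (\<Sum>i\<in>insert j I. v $ i *\<^sub>R axis i 1)) = f (p + v $ j *\<^sub>R axis j 1)" by simp
    ultimately show ?case using insert(3)[folded p_def] by linarith
  qed auto
  show "\<exists>d>0. \<forall>y. norm (y - x) < d \<longrightarrow>
      norm (f y - f x - (\<Sum>i\<in>UNIV. (y - x) $ i * partial_deriv i f x)) \<le> e * norm (y - x)"
  proof (intro exI conjI allI impI)
    fix y assume y: "norm (y - x) < d"
    have "(\<Sum>i\<in>UNIV. (y - x) $ i *\<^sub>R axis i 1) = y - x"
      using basis_expansion[of "y - x"] by (simp add: scalar_mult_eq_scaleR)
    with main[OF y, of UNIV]
    have "\<bar>f y - f x - (\<Sum>i\<in>UNIV. (y - x) $ i * partial_deriv i f x)\<bar> \<le> (\<Sum>i\<in>UNIV. \<epsilon> * \<bar>(y - x) $ i\<bar>)"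
      by simp
    also have "\<dots> \<le> (\<Sum>i\<in>(UNIV::'n set). \<epsilon> * norm (y - x))"
      using \<epsilon> by (intro sum_mono mult_left_mono component_le_norm_cart) auto
    also have "\<dots> = e * norm (y - x)" by (simp add: \<epsilon>_def)
    finally show "norm (f y - f x - (\<Sum>i\<in>UNIV. (y - x) $ i * partial_deriv i f x)) \<le> e * norm (y - x)"
      by simp
  qed (rule d)
qed

text \<open>Total differentiability, of \<open>f\<close> near \<open>x\<close> and then of each
  first partial derivative at \<open>x\<close>, makes the matrix of second partials the derivative
  of the gradient. This links the formulation of the problem to \<open>has_lap\<close>.\<close>

lemma class_C_has_lap:
  fixes f :: "real ^ 'n \<Rightarrow> real"
  assumes "class_C 2 S f" and S: "open S" "x \<in> S"
  shows "\<exists>\<gamma>. has_lap f \<gamma> (laplacian f x) x"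
proof -
  have C: "\<And>i y. y \<in> S \<Longrightarrow> has_partial_at i f y" "\<And>i. continuous_on S (partial_deriv i f)"
    "\<And>i j y. y \<in> S \<Longrightarrow> has_partial_at j (partial_deriv i f) y"
    "\<And>i j. continuous_on S (partial_deriv j (partial_deriv i f))"
    using assms(1) by (auto simp: numeral_2_eq_2)
  have vec: "(\<chi> i. F i) = (\<Sum>i\<in>UNIV. F i *\<^sub>R axis i 1)" for F :: "'n \<Rightarrow> real"
    using basis_expansion[of "\<chi> i. F i"] by (simp add: scalar_mult_eq_scaleR)
  define A where "A v = (\<chi> i. \<Sum>j\<in>UNIV. v $ j * partial_deriv j (partial_deriv i f) x)" for v :: "real ^ 'n"
  have "has_lap f (\<chi> i. partial_deriv i f x) (laplacian f x) x"
  proof (rule has_lapI[where g="\<lambda>y. \<chi> i. partial_deriv i f y" and A=A])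
    have "\<forall>\<^sub>F y in nhds x. y \<in> S" using S by (simp add: eventually_nhds_in_open)
    then show "\<forall>\<^sub>F y in nhds x. (f has_derivative (\<lambda>v. (\<chi> i. partial_deriv i f y) \<bullet> v)) (at y)"
    proof eventually_elim
      case (elim y)
      show ?case
        using has_derivative_of_continuous_partials[OF S(1) elim C(1,2)]
        by (simp add: inner_vec_def mult.commute)
    qed
    show "((\<lambda>y. \<chi> i. partial_deriv i f y) has_derivative A) (at x)"
      unfolding A_def vec
      by (intro has_derivative_sum has_derivative_scaleR_left
          has_derivative_of_continuous_partials[OF S C(3,4)])
    have "(Basis :: (real ^ 'n) set) = (\<lambda>i. axis i 1) ` UNIV" by (auto simp: Basis_vec_def)
    then have "(\<Sum>b\<in>Basis. A b \<bullet> b) = (\<Sum>i\<in>UNIV. A (axis i 1) \<bullet> axis i 1)"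
      by (intro sum.reindex_cong) (auto simp: inj_on_def axis_eq_axis)
    also have "A (axis i 1) $ i = partial_deriv i (partial_deriv i f) x" for i
      by (simp add: A_def axis_def if_distrib[of "\<lambda>z. z * _"] cong: if_cong)
    then have "(\<Sum>i\<in>UNIV. A (axis i 1) \<bullet> axis i 1) = laplacian f x"
      by (simp add: laplacian_def inner_axis)
    finally show "laplacian f x = (\<Sum>b\<in>Basis. A b \<bullet> b)" ..
  qed simp
  then show ?thesis ..
qed

section \<open>Radial barriers\<close>

lemma has_derivative_norm_powr:
  fixes x :: "'a::euclidean_space"
  assumes "x \<noteq> 0"
  shows "((\<lambda>y. norm y powr q) has_derivative (\<lambda>v. (q * norm x powr (q - 2)) * (x \<bullet> v))) (at x)"
proof -
  have n: "norm x > 0" using assms by simp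
  have "((\<lambda>r. r powr q) has_derivative (\<lambda>h. q * norm x powr (q - 1) * h)) (at (norm x))"
    using has_real_derivative_powr[OF n, of q] by (simp add: has_field_derivative_def)
  from has_derivative_compose[OF has_derivative_norm[OF assms] this]
  have "((\<lambda>y. norm y powr q) has_derivative (\<lambda>v. q * norm x powr (q - 1) * (v \<bullet> sgn x))) (at x)" .
  moreover have "q * norm x powr (q - 1) * (v \<bullet> sgn x) = (q * norm x powr (q - 2)) * (x \<bullet> v)" for v
  proof -
    have "norm x powr (q - 1) = norm x powr (q - 2) * norm x"
      using n by (simp add: powr_diff power2_eq_square powr_numeral)
    then show ?thesis using n by (simp add: sgn_div_norm inner_commute)
  qed
  ultimately show ?thesis by simp
qed

lemma has_lap_norm_powr:
  fixes x :: "'a::euclidean_space"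
  assumes "x \<noteq> 0"
  shows "has_lap (\<lambda>y. norm y powr q) ((q * norm x powr (q - 2)) *\<^sub>R x)
    (q * (q + real DIM('a) - 2) * norm x powr (q - 2)) x"
proof (rule has_lapI[where g="\<lambda>y. (q * norm y powr (q - 2)) *\<^sub>R y" and
      A="\<lambda>v. (q * norm x powr (q - 2)) *\<^sub>R v + (q * (((q - 2) * norm x powr (q - 2 - 2)) * (x \<bullet> v))) *\<^sub>R x"])
  have "\<forall>\<^sub>F y in nhds x. y \<in> - {0}" using assms by (intro eventually_nhds_in_open) auto
  then show "\<forall>\<^sub>F y in nhds x. ((\<lambda>y. norm y powr q) has_derivative (\<lambda>v. ((q * norm y powr (q - 2)) *\<^sub>R y) \<bullet> v)) (at y)"
  proof eventually_elim
    case (elim y)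
    then show ?case using has_derivative_norm_powr[of y q] by simp
  qed
  show "((\<lambda>y. (q * norm y powr (q - 2)) *\<^sub>R y) has_derivative (\<lambda>v. (q * norm x powr (q - 2)) *\<^sub>R v +
      (q * (((q - 2) * norm x powr (q - 2 - 2)) * (x \<bullet> v))) *\<^sub>R x)) (at x)"
    by (intro has_derivative_scaleR has_derivative_mult_right has_derivative_norm_powr has_derivative_ident assms)
  have s0: "norm x powr (q - 2) = norm x powr (q - 2 - 2) * (x \<bullet> x)"
    using powr_add[of "norm x" "q - 2 - 2" 2] assms by (simp add: dot_square_norm)
  have s1: "(\<Sum>i\<in>Basis. (\<alpha> *\<^sub>R i + \<beta> i *\<^sub>R x) \<bullet> i) = \<alpha> * real DIM('a) + (\<Sum>i\<in>Basis. \<beta> i * (x \<bullet> i))"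
    for \<alpha> \<beta> by (simp add: inner_add_left sum.distrib)
  have s2: "(\<Sum>i\<in>Basis. q * ((q - 2) * norm x powr (q - 2 - 2) * (x \<bullet> i)) * (x \<bullet> i)) =
      q * (q - 2) * norm x powr (q - 2 - 2) * (x \<bullet> x)"
    by (simp add: euclidean_inner[of x x] sum_distrib_left mult.assoc)
  show "q * (q + real DIM('a) - 2) * norm x powr (q - 2) =
    (\<Sum>i\<in>Basis. ((q * norm x powr (q - 2)) *\<^sub>R i + (q * (((q - 2) * norm x powr (q - 2 - 2)) * (x \<bullet> i))) *\<^sub>R x) \<bullet> i)"
    unfolding s1 s2 by (simp add: s0 algebra_simps)
qed simp

definition heat_coeff :: "real \<Rightarrow> 'a::euclidean_space \<Rightarrow> real" where
  "heat_coeff a x = 1 / a * norm x powr (2 - a)"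

text \<open>Two radial variables are needed. In \<open>|x| powr a\<close> the coefficients are
  linear and constant, which suits exponential barriers; in \<open>|x| powr (a / 2)\<close> the
  leading coefficient is constant, which suits a profile travelling with fixed width.\<close>

lemma heat_coeff_lap_powr:
  fixes x :: "'a::euclidean_space"
  assumes "x \<noteq> 0" "a > 0"
    and F: "\<And>z. (F has_real_derivative F' z) (at z)"
    and F': "\<And>z. (F' has_real_derivative F'' z) (at z)"
  shows "\<exists>\<gamma> l. has_lap (\<lambda>y. F (norm y powr a)) \<gamma> l x \<and>
      heat_coeff a x * l = a * norm x powr a * F'' (norm x powr a) + (a + real DIM('a) - 2) * F' (norm x powr a)"
    (is ?A)
    and "\<exists>\<gamma> l. has_lap (\<lambda>y. F (norm y powr (a / 2))) \<gamma> l x \<and>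
      heat_coeff a x * l = a / 4 * F'' (norm x powr (a / 2)) +
        (a / 2 + real DIM('a) - 2) / 2 / norm x powr (a / 2) * F' (norm x powr (a / 2))"
    (is ?B)
proof -
  have n: "norm x > 0" using assms(1) by simp
  have pw: "norm x powr p * norm x powr q = norm x powr (p + q)" for p q
    by (simp add: powr_add)
  have sq: "x \<bullet> x = norm x powr 2" using n by (simp add: dot_square_norm)
  have e1: "heat_coeff a x * (F'' z * ((w *\<^sub>R x) \<bullet> (w *\<^sub>R x)) + F' z * l) =
      F'' z * (heat_coeff a x * (w * w * (x \<bullet> x))) + F' z * (heat_coeff a x * l)" for w z l
    by (simp add: algebra_simps)
  have e2: "heat_coeff a x * (q * norm x powr (q - 2) * (q * norm x powr (q - 2)) * (x \<bullet> x)) =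
      q * q / a * norm x powr (2 * q - a)" for q
  proof -
    have "heat_coeff a x * (q * norm x powr (q - 2) * (q * norm x powr (q - 2)) * (x \<bullet> x)) =
      q * q / a * (norm x powr (2 - a) * norm x powr (q - 2) * norm x powr (q - 2) * norm x powr 2)"
      unfolding sq heat_coeff_def by simp
    also have "\<dots> = q * q / a * norm x powr (2 * q - a)" unfolding pw by (simp add: algebra_simps)
    finally show ?thesis .
  qed
  have e3: "heat_coeff a x * (m * norm x powr (q - 2)) = m / a * norm x powr (q - a)" for q m
  proof -
    have "heat_coeff a x * (m * norm x powr (q - 2)) = m / a * (norm x powr (2 - a) * norm x powr (q - 2))"
      unfolding heat_coeff_def by simp
    also have "\<dots> = m / a * norm x powr (q - a)" unfolding pw by (simp add: algebra_simps)
    finally show ?thesis .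
  qed
  have lap: "\<exists>\<gamma> l. has_lap (\<lambda>y. F (norm y powr q)) \<gamma> l x \<and>
      heat_coeff a x * l = q * q / a * norm x powr (2 * q - a) * F'' (norm x powr q) +
        q * (q + real DIM('a) - 2) / a * norm x powr (q - a) * F' (norm x powr q)" for q
    by (intro exI conjI, rule has_lap_chain[OF has_lap_norm_powr[OF assms(1)] F F'])
      (unfold e1 e2 e3, simp add: mult_ac)
  have "norm x powr (a / 2 - a) = 1 / norm x powr (a / 2)"
    using powr_minus_divide[of "norm x" "a / 2"] by simp
  then have eqs: "a * a / a * norm x powr (2 * a - a) * s + a * (a + real DIM('a) - 2) / a * norm x powr (a - a) * w
      = a * norm x powr a * s + (a + real DIM('a) - 2) * w"
    "a / 2 * (a / 2) / a * norm x powr (2 * (a / 2) - a) * s + a / 2 * (a / 2 + real DIM('a) - 2) / a * norm x powr (a / 2 - a) * w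
      = a / 4 * s + (a / 2 + real DIM('a) - 2) / 2 / norm x powr (a / 2) * w" for s w
    using assms(2) n by simp_all
  show ?A using lap[of a] unfolding eqs(1) .
  show ?B using lap[of "a / 2"] unfolding eqs(2) .
qed

lemma heat_coeff_nonneg: "a > 0 \<Longrightarrow> heat_coeff a x \<ge> 0"
  by (simp add: heat_coeff_def)

text \<open>The rate \<open>k\<close> rises from \<kappa> to at most \<open>2 * \<kappa>\<close>. In
  the factor \<open>\<kappa> * \<mu> * (\<rho> + \<sigma>)\<close> of the time derivative, the part
  with \<rho> absorbs \<open>a * (k * k) * \<rho>\<close> because \<mu> is at least
  \<open>4 * a * \<kappa>\<close>, and the part with \<sigma>, added for this purpose, absorbs the
  drift \<open>b * k\<close>.\<close>

lemma subcal_neg_exp_barrier: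
  fixes x :: "'a::euclidean_space"
  assumes "a > 0" "a + real DIM('a) - 2 > 0" "\<kappa> > 0" "x \<noteq> 0"
    and \<mu>: "\<mu> \<ge> 4 * a * \<kappa>" "\<mu> * \<sigma> \<ge> 2 * (a + real DIM('a) - 2)"
    and t: "0 \<le> \<mu> * (t - t0)" "\<mu> * (t - t0) \<le> 1"
  shows "subcal (heat_coeff a) (\<lambda>t x. - exp (\<kappa> * (1 + \<mu> * (t - t0)) * (norm x powr a + \<sigma>))) t x"
proof -
  define b where "b = a + real DIM('a) - 2"
  define k where "k = \<kappa> * (1 + \<mu> * (t - t0))"
  define \<rho> where "\<rho> = norm x powr a"
  have k: "0 \<le> k" "k \<le> 2 * \<kappa>" using t assms(3) by (auto simp: k_def)
  have \<rho>: "\<rho> \<ge> 0" by (simp add: \<rho>_def)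
  obtain \<gamma> l where l: "has_lap (\<lambda>y. - exp (k * (norm y powr a + \<sigma>))) \<gamma> l x"
    "heat_coeff a x * l = a * \<rho> * (- (k * k * exp (k * (\<rho> + \<sigma>)))) + b * (- (k * exp (k * (\<rho> + \<sigma>))))"
    using heat_coeff_lap_powr(1)[OF assms(4,1), of "\<lambda>z. - exp (k * (z + \<sigma>))"
        "\<lambda>z. - (k * exp (k * (z + \<sigma>)))" "\<lambda>z. - (k * k * exp (k * (z + \<sigma>)))"]
    by (fastforce simp: \<rho>_def b_def intro!: derivative_eq_intros)
  have "((\<lambda>s. - exp (\<kappa> * (1 + \<mu> * (s - t0)) * (norm x powr a + \<sigma>))) has_real_derivative
      - (\<kappa> * \<mu> * (\<rho> + \<sigma>) * exp (k * (\<rho> + \<sigma>)))) (at t)"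
    by (auto intro!: derivative_eq_intros simp: k_def \<rho>_def)
  moreover have "- (\<kappa> * \<mu> * (\<rho> + \<sigma>) * exp (k * (\<rho> + \<sigma>))) \<le> heat_coeff a x * l"
  proof -
    have "k * k \<le> (2 * \<kappa>) * (2 * \<kappa>)" using k by (intro mult_mono) auto
    then have "a * (k * k) \<le> a * (2 * \<kappa> * (2 * \<kappa>))" using assms(1) by (intro mult_left_mono) auto
    also have "\<dots> \<le> \<kappa> * \<mu>" using mult_left_mono[OF \<mu>(1), of \<kappa>] assms(3) by (simp add: algebra_simps)
    finally have "a * (k * k) * \<rho> \<le> \<kappa> * \<mu> * \<rho>" using \<rho> by (rule mult_right_mono)
    moreover have "b * k \<le> \<kappa> * (\<mu> * \<sigma>)"
    proof -
      have "b * k \<le> b * (2 * \<kappa>)" using k assms(2) by (intro mult_left_mono) (auto simp: b_def)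
      also have "\<dots> \<le> \<kappa> * (\<mu> * \<sigma>)" using mult_left_mono[OF \<mu>(2), of \<kappa>] assms(3) by (simp add: b_def algebra_simps)
      finally show ?thesis .
    qed
    ultimately have "a * (k * k) * \<rho> + b * k \<le> \<kappa> * \<mu> * (\<rho> + \<sigma>)" by (simp add: algebra_simps)
    then have "(a * (k * k) * \<rho> + b * k) * exp (k * (\<rho> + \<sigma>)) \<le> \<kappa> * \<mu> * (\<rho> + \<sigma>) * exp (k * (\<rho> + \<sigma>))"
      by (intro mult_right_mono) auto
    then show ?thesis unfolding l(2) by (simp add: algebra_simps)
  qed
  ultimately show ?thesis using l(1) unfolding subcal_def k_def by blast
qed

text \<open>Near the edge of the cubed profile the second derivative is of order \<open>p\<close>
  but the transport terms are of order \<open>p\<^sup>2\<close>, so diffusion wins there; further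
  inside, the damping \<Lambda> wins. The lower bound on the radius keeps the drift \<open>m\<close>
  bounded.\<close>

lemma subcal_travelling_bump:
  fixes x :: "'a::euclidean_space"
  assumes "a > 0" "x \<noteq> 0" and y: "norm x powr (a / 2) \<ge> 1 / 2"
    and W: "\<bar>v\<bar> + \<bar>a / 2 + real DIM('a) - 2\<bar> \<le> W" "96 * a * \<Lambda> \<ge> (30 * a + 12 * W)\<^sup>2"
    and pos: "1 - (2 * (norm x powr (a / 2) - (c - v * t)))\<^sup>2 > 0"
  shows "subcal (heat_coeff a) (\<lambda>t x. exp (- \<Lambda> * t) * (1 - (2 * (norm x powr (a / 2) - (c - v * t)))\<^sup>2) ^ 3) t x"
proof -
  define E where "E = exp (- \<Lambda> * t)"
  define m where "m = (a / 2 + real DIM('a) - 2) / 2 / norm x powr (a / 2)"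
  define z where "z = 2 * (norm x powr (a / 2) - (c - v * t))"
  define p where "p = 1 - z\<^sup>2"
  define F where "F y = E * (1 - (2 * (y - (c - v * t)))\<^sup>2) ^ 3" for y
  define F' where "F' y = E * (3 * (1 - (2 * (y - (c - v * t)))\<^sup>2) ^ 2 * (- 8 * (y - (c - v * t))))" for y
  define F'' where "F'' y = E * (6 * (1 - (2 * (y - (c - v * t)))\<^sup>2) * (- 8 * (y - (c - v * t)))\<^sup>2
      - 24 * (1 - (2 * (y - (c - v * t)))\<^sup>2) ^ 2)" for y
  have F: "(F has_real_derivative F' y) (at y)" for y
    unfolding F_def F'_def by (auto intro!: derivative_eq_intros simp: algebra_simps power2_eq_square)
  have F': "(F' has_real_derivative F'' y) (at y)" for y
    unfolding F''_def F'_def by (auto intro!: derivative_eq_intros simp: algebra_simps power2_eq_square)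
  obtain \<gamma> l where l: "has_lap (\<lambda>y. F (norm y powr (a / 2))) \<gamma> l x"
    "heat_coeff a x * l = a / 4 * F'' (norm x powr (a / 2)) + m * F' (norm x powr (a / 2))"
    using heat_coeff_lap_powr(2)[OF assms(2,1) F F'] unfolding m_def by blast
  have p: "0 < p" "p \<le> 1" using pos by (auto simp: p_def z_def)
  have z: "\<bar>z\<bar> \<le> 1" using p abs_square_less_1[of z] by (simp add: p_def)
  have E: "E > 0" by (simp add: E_def)
  have m: "\<bar>m\<bar> \<le> \<bar>a / 2 + real DIM('a) - 2\<bar>"
  proof -
    have "\<bar>a / 2 + real DIM('a) - 2\<bar> / 2 / norm x powr (a / 2) \<le> \<bar>a / 2 + real DIM('a) - 2\<bar> / 2 / (1 / 2)"
      using y by (intro divide_left_mono) auto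
    then show ?thesis by (simp add: m_def abs_divide)
  qed
  have "((\<lambda>t. exp (- \<Lambda> * t) * (1 - (2 * (norm x powr (a / 2) - (c - v * t)))\<^sup>2) ^ 3) has_real_derivative
      E * (- \<Lambda> * p ^ 3 - 12 * v * z * p\<^sup>2)) (at t)"
  proof -
    define Z where "Z t = 2 * (norm x powr (a / 2) - (c - v * t))" for t
    have Z: "(Z has_real_derivative 2 * v) (at t)"
      unfolding Z_def by (auto intro!: derivative_eq_intros)
    have P: "((\<lambda>t. 1 - (Z t)\<^sup>2) has_real_derivative - (4 * v * z)) (at t)"
      by (rule derivative_eq_intros Z refl)+ (simp add: Z_def z_def)
    have "((\<lambda>t. exp (- \<Lambda> * t) * (1 - (Z t)\<^sup>2) ^ 3) has_real_derivative
        (- \<Lambda> * E) * p ^ 3 + (3 * p\<^sup>2 * (- (4 * v * z))) * E) (at t)"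
      by (rule derivative_eq_intros P refl)+ (simp add: E_def p_def z_def Z_def)
    then show ?thesis unfolding Z_def by (simp add: algebra_simps)
  qed
  moreover have "E * (- \<Lambda> * p ^ 3 - 12 * v * z * p\<^sup>2) \<le> heat_coeff a x * l"
  proof -
    have hl: "heat_coeff a x * l = E * (a * (24 * z\<^sup>2 * p - 6 * p\<^sup>2) - 12 * m * z * p\<^sup>2)"
    proof -
      have w: "norm x powr (a / 2) - (c - v * t) = z / 2" by (simp add: z_def)
      have "2 * (z / 2) = z" "- 8 * (z / 2) = - 4 * z" by simp_all
      then show ?thesis
        unfolding l(2) F''_def F'_def w by (simp add: p_def[symmetric] power_mult_distrib algebra_simps)
    qed
    have "\<bar>v - m\<bar> \<le> W" using m W(1) by linarith
    then have "\<bar>v - m\<bar> * \<bar>z\<bar> \<le> W * 1" using z by (intro mult_mono) auto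
    then have "\<bar>(v - m) * z\<bar> \<le> W" by (simp add: abs_mult)
    then have "(v - m) * z * p \<ge> - W * p"
      using p by (intro mult_right_mono) auto
    \<comment> \<open>This quadratic in \<open>p\<close> is what remains of the inequality after
      division by \<open>p\<close> and the substitution \<open>z\<^sup>2 = 1 - p\<close>;
      \<open>W(2)\<close> says that its discriminant is not positive.\<close>
    moreover have "24 * a - (30 * a + 12 * W) * p + \<Lambda> * p\<^sup>2 \<ge> 0"
    proof -
      have "96 * a * (24 * a - (30 * a + 12 * W) * p + \<Lambda> * p\<^sup>2) =
          (48 * a - (30 * a + 12 * W) * p)\<^sup>2 + (96 * a * \<Lambda> - (30 * a + 12 * W)\<^sup>2) * p\<^sup>2"
        by (simp add: algebra_simps power2_eq_square)
      also have "\<dots> \<ge> 0" using W(2) by simp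
      finally show ?thesis using assms(1) by (simp add: zero_le_mult_iff)
    qed
    ultimately have "24 * a - 30 * a * p + \<Lambda> * p\<^sup>2 + 12 * ((v - m) * z * p) \<ge> 0"
      by (simp add: algebra_simps)
    moreover have "a * (24 * (1 - p) - 6 * p) + \<Lambda> * p\<^sup>2 + 12 * (v - m) * z * p =
        24 * a - 30 * a * p + \<Lambda> * p\<^sup>2 + 12 * ((v - m) * z * p)"
      by (simp add: algebra_simps)
    moreover have "1 - p = z\<^sup>2" by (simp add: p_def)
    ultimately have "0 \<le> p * (a * (24 * z\<^sup>2 - 6 * p) + \<Lambda> * p\<^sup>2 + 12 * (v - m) * z * p)"
      using p by (intro mult_nonneg_nonneg) simp_all
    then have "- \<Lambda> * p ^ 3 - 12 * v * z * p\<^sup>2 \<le> a * (24 * z\<^sup>2 * p - 6 * p\<^sup>2) - 12 * m * z * p\<^sup>2"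
      by (simp add: algebra_simps power2_eq_square power3_eq_cube)
    then show ?thesis unfolding hl using E by (intro mult_left_mono) auto
  qed
  ultimately show ?thesis using l(1) unfolding subcal_def F_def E_def by blast
qed

section \<open>Averages over rotations\<close>

text \<open>Lists rather than sets: repetitions count, so that an average of averages is again an
  average over one list.\<close>

definition avg :: "('a \<Rightarrow> 'a) list \<Rightarrow> ('a \<Rightarrow> real) \<Rightarrow> 'a \<Rightarrow> real" where
  "avg Rs f x = (\<Sum>R\<leftarrow>Rs. f (R x)) / real (length Rs)"

lemma avg_mono:
  assumes "\<And>R. R \<in> set Rs \<Longrightarrow> f (R x) \<le> g (R y)"
  shows "avg Rs f x \<le> avg Rs g y"
  unfolding avg_def using assms by (intro divide_right_mono sum_list_mono) auto

lemma avg_const: "Rs \<noteq> [] \<Longrightarrow> avg Rs (\<lambda>_. b) x = b"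
  by (simp add: avg_def sum_list_triv)

lemma avg_le: "Rs \<noteq> [] \<Longrightarrow> (\<And>R. R \<in> set Rs \<Longrightarrow> f (R x) \<le> b) \<Longrightarrow> avg Rs f x \<le> b"
  using avg_mono[of Rs f x "\<lambda>_. b" x] by (simp add: avg_const)

lemma avg_ge: "Rs \<noteq> [] \<Longrightarrow> (\<And>R. R \<in> set Rs \<Longrightarrow> b \<le> f (R x)) \<Longrightarrow> b \<le> avg Rs f x"
  using avg_mono[of Rs "\<lambda>_. b" x f x] by (simp add: avg_const)

lemma avg_uminus: "avg Rs (\<lambda>x. - f x) x = - avg Rs f x"
proof -
  have "(\<Sum>R\<leftarrow>Rs. - f (R x)) = - (\<Sum>R\<leftarrow>Rs. f (R x))" by (induction Rs) auto
  then show ?thesis by (simp add: avg_def)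
qed

text \<open>Keeps iterated averaging within finite lists. The inner average is evaluated at
  \<open>R x\<close>, hence the order in \<open>S \<circ> R\<close>.\<close>

lemma avg_avg: "avg Rs (avg Ss f) x = avg (concat (map (\<lambda>R. map (\<lambda>S. S \<circ> R) Ss) Rs)) f x"
proof -
  have "length (concat (map (\<lambda>R. map (\<lambda>S. S \<circ> R) Ss) Rs)) = length Rs * length Ss"
    by (induction Rs) auto
  moreover have "(\<Sum>R\<leftarrow>Rs. avg Ss f (R x)) =
      (\<Sum>R\<leftarrow>concat (map (\<lambda>R. map (\<lambda>S. S \<circ> R) Ss) Rs). f (R x)) / real (length Ss)"
    by (induction Rs) (auto simp: avg_def add_divide_distrib o_def)
  ultimately show ?thesis by (simp add: avg_def[of Rs] avg_def[of "concat _"] mult.commute)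
qed

text \<open>A single low member pulls the average down by its share. This drives the contraction of
  the oscillation on spheres; with signs reversed it bounds an average of nonnegative terms from
  below by one of them.\<close>

lemma avg_le_improved:
  assumes "\<And>R. R \<in> set Rs \<Longrightarrow> f (R x) \<le> b" and "S \<in> set Rs" "f (S x) \<le> b - d"
  shows "avg Rs f x \<le> b - d / real (length Rs)"
proof -
  have "(\<Sum>R\<leftarrow>Rs. f (R x)) \<le> (\<Sum>R\<leftarrow>remove1 S Rs. b) + (b - d)"
  proof -
    have "(\<Sum>R\<leftarrow>remove1 S Rs. f (R x)) \<le> (\<Sum>R\<leftarrow>remove1 S Rs. b)"
      by (intro sum_list_mono assms(1)) (rule subsetD[OF set_remove1_subset])
    then show ?thesis
      using assms(3) sum_list_map_remove1[OF assms(2), of "\<lambda>R. f (R x)"] by linarith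
  qed
  also have "\<dots> = real (length Rs) * b - d"
  proof -
    have "length Rs > 0" using assms(2) by auto
    then have len: "real (length (remove1 S Rs)) = real (length Rs) - 1"
      using assms(2) by (simp add: length_remove1 of_nat_diff Suc_leI)
    show ?thesis by (simp add: sum_list_triv len left_diff_distrib)
  qed
  finally have "avg Rs f x \<le> (real (length Rs) * b - d) / real (length Rs)"
    unfolding avg_def by (intro divide_right_mono) auto
  then show ?thesis using assms(2) by (cases "Rs = []") (auto simp: diff_divide_distrib)
qed

text \<open>Orthogonal maps leave the Laplacian unchanged and \<open>c\<close> is constant on the
  sphere through \<open>x\<close>, so the inequality at each \<open>R x\<close> becomes one at
  \<open>x\<close> with the same coefficient.\<close>

lemma subcal_avg:
  fixes f :: "real \<Rightarrow> 'a::euclidean_space \<Rightarrow> real"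
  assumes "\<And>R. R \<in> set Rs \<Longrightarrow> orthogonal_transformation R"
    and "\<And>R. R \<in> set Rs \<Longrightarrow> subcal c f t (R x)"
    and "\<And>y. norm y = norm x \<Longrightarrow> c y = c x"
  shows "subcal c (\<lambda>t. avg Rs (f t)) t x"
proof -
  have "subcal c (\<lambda>t x. \<Sum>R\<leftarrow>Rs. f t (R x)) t x"
  proof (rule subcal_sum_list)
    fix R assume R: "R \<in> set Rs"
    show "subcal c (\<lambda>t x. f t (R x)) t x"
      by (rule subcal_orthogonal[where R=R, OF assms(2)[OF R] assms(1)[OF R]])
        (rule assms(3)[OF orthogonal_transformation_norm[OF assms(1)[OF R]]])
  qed
  from subcal_cmult[OF this, of "1 / real (length Rs)"] show ?thesis
    by (simp add: avg_def[abs_def])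
qed

lemma continuous_on_avg:
  fixes f :: "real \<Rightarrow> 'a::euclidean_space \<Rightarrow> real"
  assumes "continuous_on (I \<times> K) (\<lambda>p. f (fst p) (snd p))"
    and R: "\<And>R. R \<in> set Rs \<Longrightarrow> orthogonal_transformation R"
    and K: "\<And>x y. x \<in> K \<Longrightarrow> norm y = norm x \<Longrightarrow> y \<in> K"
  shows "continuous_on (I \<times> K) (\<lambda>p. avg Rs (f (fst p)) (snd p))"
proof -
  have "continuous_on (I \<times> K) (\<lambda>p. f (fst p) (R (snd p)))" if "R \<in> set Rs" for R
  proof -
    have ot: "orthogonal_transformation R" using R that by blast
    have "continuous_on (I \<times> K) (\<lambda>p. R (snd p))"
      by (rule bounded_linear.continuous_on[OF linear_conv_bounded_linear[THEN iffD1, OF orthogonal_transformation_linear[OF ot]]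
            continuous_on_snd[OF continuous_on_id]])
    then have "continuous_on (I \<times> K) (\<lambda>p. (fst p, R (snd p)))"
      by (intro continuous_intros)
    moreover have "R x \<in> K" if "x \<in> K" for x
      using K[OF that] orthogonal_transformation_norm[OF ot] by blast
    then have "(\<lambda>p. (fst p, R (snd p))) ` (I \<times> K) \<subseteq> I \<times> K" by auto
    ultimately show ?thesis
      by (rule continuous_on_compose2[OF assms(1), of "I \<times> K" "\<lambda>p. (fst p, R (snd p))", simplified fst_conv snd_conv])
  qed
  then have "continuous_on (I \<times> K) (\<lambda>p. \<Sum>R\<leftarrow>Rs. f (fst p) (R (snd p)))"
    by (induction Rs) (auto intro!: continuous_intros)
  then show ?thesis unfolding avg_def by (cases "Rs = []") (auto intro!: continuous_intros)
qed

text \<open>For each pair of points in a finite net of the unit sphere take an orthogonal map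
  carrying one to the other. The map belonging to net points close to the directions of
  \<open>x\<close> and \<open>x'\<close> errs by at most twice the mesh, scaled by the norm.\<close>

lemma rotation_net:
  assumes "\<delta> > 0"
  obtains L :: "(real ^ 'n \<Rightarrow> real ^ 'n) list" where "L \<noteq> []"
    "\<And>R. R \<in> set L \<Longrightarrow> orthogonal_transformation R"
    "\<And>x x'. norm x = norm x' \<Longrightarrow> norm x \<le> r \<Longrightarrow> \<exists>R\<in>set L. norm (R x - x') < \<delta>"
proof -
  \<comment> \<open>The mesh makes \<open>2 * (\<bar>r\<bar> * \<epsilon>)\<close> smaller than
    \<delta>; the \<open>+ 1\<close> makes this strict and excludes division by zero.\<close>
  define \<epsilon> where "\<epsilon> = \<delta> / (2 * (\<bar>r\<bar> + 1))"
  have \<epsilon>: "\<epsilon> > 0" using assms by (simp add: \<epsilon>_def)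
  have "compact (sphere (0::real ^ 'n) 1)" by simp
  moreover have "sphere (0::real ^ 'n) 1 \<subseteq> (\<Union>z\<in>sphere 0 1. ball z \<epsilon>)" using \<epsilon> by auto
  ultimately obtain Z where Z: "Z \<subseteq> sphere (0::real ^ 'n) 1" "finite Z" "sphere 0 1 \<subseteq> (\<Union>z\<in>Z. ball z \<epsilon>)"
    by (rule compactE_image[OF _ open_ball]) blast
  obtain zs where zs: "set zs = Z" using finite_list[OF Z(2)] by blast
  have "\<forall>z\<in>Z. \<forall>z'\<in>Z. \<exists>R. orthogonal_transformation R \<and> R z = z'"
  proof (intro ballI)
    fix z z' assume "z \<in> Z" "z' \<in> Z"
    then have "z \<in> sphere 0 1" "z' \<in> sphere 0 1" using Z(1) by blast+
    then have "norm z = norm z'" by simp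
    then show "\<exists>R. orthogonal_transformation R \<and> R z = z'"
      by (rule orthogonal_transformation_exists) blast
  qed
  then obtain \<Phi> where \<Phi>: "\<And>z z'. z \<in> Z \<Longrightarrow> z' \<in> Z \<Longrightarrow> orthogonal_transformation (\<Phi> z z') \<and> \<Phi> z z' z = z'"
    by metis
  define L where "L = concat (map (\<lambda>z. map (\<Phi> z) zs) zs)"
  have setL: "set L = {\<Phi> z z' | z z'. z \<in> Z \<and> z' \<in> Z}" by (auto simp: L_def zs)
  have unit: "axis undefined 1 \<in> sphere (0::real ^ 'n) 1" by (simp add: norm_axis_1)
  then have "Z \<noteq> {}" using Z(3) by auto
  show thesis
  proof (rule that)
    show "L \<noteq> []" using \<open>Z \<noteq> {}\<close> setL by (metis (mono_tags, lifting) Collect_empty_eq empty_set ex_in_conv)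
    show "orthogonal_transformation R" if "R \<in> set L" for R using that \<Phi> setL by auto
    fix x x' :: "real ^ 'n" assume n: "norm x = norm x'" "norm x \<le> r"
    have ex: "\<exists>z\<in>Z. norm (w - norm w *\<^sub>R z) \<le> norm w * \<epsilon>" for w :: "real ^ 'n"
    proof (cases "w = 0")
      case True then show ?thesis using \<open>Z \<noteq> {}\<close> by auto
    next
      case False
      then have "w /\<^sub>R norm w \<in> sphere 0 1" by simp
      then obtain z where z: "z \<in> Z" "dist z (w /\<^sub>R norm w) < \<epsilon>" using Z(3) by fastforce
      have "w - norm w *\<^sub>R z = norm w *\<^sub>R (w /\<^sub>R norm w - z)"
        using False by (simp add: scaleR_diff_right)
      then have "norm (w - norm w *\<^sub>R z) = norm w * dist z (w /\<^sub>R norm w)"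
        by (simp add: dist_norm norm_minus_commute)
      then show ?thesis using z by (intro bexI[of _ z]) (auto intro: mult_left_mono)
    qed
    obtain z z' where z: "z \<in> Z" "norm (x - norm x *\<^sub>R z) \<le> norm x * \<epsilon>"
      and z': "z' \<in> Z" "norm (x' - norm x' *\<^sub>R z') \<le> norm x' * \<epsilon>"
      using ex by blast
    define R where "R = \<Phi> z z'"
    have ot: "orthogonal_transformation R" and Rz: "R z = z'" using \<Phi> z(1) z'(1) by (auto simp: R_def)
    have lin: "linear R" using ot by (rule orthogonal_transformation_linear)
    have "R x - x' = R (x - norm x *\<^sub>R z) - (x' - norm x' *\<^sub>R z')"
      using n(1) Rz by (simp add: linear_diff[OF lin] linear_cmul[OF lin])
    then have "norm (R x - x') \<le> norm (x - norm x *\<^sub>R z) + norm (x' - norm x' *\<^sub>R z')"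
      using norm_triangle_ineq4 orthogonal_transformation_norm[OF ot] by metis
    also have "\<dots> \<le> 2 * (norm x * \<epsilon>)" using z(2) z'(2) n by simp
    also have "\<dots> \<le> 2 * (\<bar>r\<bar> * \<epsilon>)" using n \<epsilon> by (intro mult_left_mono mult_right_mono) auto
    also have "\<dots> < 2 * ((\<bar>r\<bar> + 1) * \<epsilon>)" using \<epsilon> by (simp add: algebra_simps)
    also have "\<dots> = \<delta>"
    proof -
      have "2 * (c * (\<delta> / (2 * c))) = \<delta>" if "c \<noteq> 0" for c :: real using that by simp
      moreover have "\<bar>r\<bar> + 1 \<noteq> 0" by linarith
      ultimately show ?thesis unfolding \<epsilon>_def by blast
    qed
    finally show "\<exists>R\<in>set L. norm (R x - x') < \<delta>"
      using z(1) z'(1) by (intro bexI[of _ R]) (auto simp: setL R_def)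
  qed
qed

text \<open>Averaging once over a net of rotations contracts the oscillation on spheres, since for every
  \<open>x\<close> one of the rotations carries \<open>x\<close> close to a minimum point. Iterating makes the average
  almost radial.\<close>

lemma almost_radial_avg:
  fixes f :: "real \<Rightarrow> real ^ 'n \<Rightarrow> real"
  assumes cont: "continuous_on (I \<times> K) (\<lambda>p. f (fst p) (snd p))" and I: "compact I"
    and K: "compact K" "\<And>x y. x \<in> K \<Longrightarrow> norm y = norm x \<Longrightarrow> y \<in> K"
    and \<epsilon>: "\<epsilon> > 0"
  obtains Rs where "Rs \<noteq> []" "\<And>R. R \<in> set Rs \<Longrightarrow> orthogonal_transformation R"
    "\<And>t x x'. t \<in> I \<Longrightarrow> x \<in> K \<Longrightarrow> norm x = norm x' \<Longrightarrow> avg Rs (f t) x - avg Rs (f t) x' \<le> \<epsilon>"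
proof -
  have comp: "compact (I \<times> K)" using I K by (intro compact_Times)
  obtain D0 where D0: "\<And>p. p \<in> I \<times> K \<Longrightarrow> norm (f (fst p) (snd p)) \<le> D0"
    using compact_imp_bounded[OF compact_continuous_image[OF cont comp]] unfolding bounded_iff by blast
  obtain r where r: "\<And>x. x \<in> K \<Longrightarrow> norm x \<le> r"
    using compact_imp_bounded[OF K(1)] unfolding bounded_iff by blast
  obtain \<delta> where \<delta>: "\<delta> > 0"
    "\<And>p q. p \<in> I \<times> K \<Longrightarrow> q \<in> I \<times> K \<Longrightarrow> dist q p < \<delta> \<Longrightarrow> dist (f (fst q) (snd q)) (f (fst p) (snd p)) < \<epsilon> / 2"
    using compact_uniformly_continuous[OF cont comp] \<epsilon> unfolding uniformly_continuous_on_def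
    by (metis half_gt_zero)
  obtain L :: "(real ^ 'n \<Rightarrow> real ^ 'n) list" where L: "L \<noteq> []"
    "\<And>R. R \<in> set L \<Longrightarrow> orthogonal_transformation R"
    "\<And>x x'. norm x = norm x' \<Longrightarrow> norm x \<le> r \<Longrightarrow> \<exists>R\<in>set L. norm (R x - x') < \<delta>"
    using rotation_net[OF \<delta>(1)] by metis
  define m where "m = real (length L)"
  have m: "m \<ge> 1" using L(1) by (cases L) (auto simp: m_def)
  \<comment> \<open>\<open>\<epsilon> / 2\<close> is the fixed point of the recursion sending an
    oscillation \<open>o'\<close> to \<open>o' - (o' - \<epsilon> / 2) / m\<close>, so only the
    initial oscillation \<open>2 * D0\<close> has to decay, and it does so geometrically.\<close>
  have step: "\<exists>Rs. Rs \<noteq> [] \<and> (\<forall>R\<in>set Rs. orthogonal_transformation R) \<and>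
      (\<forall>t\<in>I. \<forall>x\<in>K. \<forall>x'. norm x = norm x' \<longrightarrow>
        avg Rs (f t) x - avg Rs (f t) x' \<le> (1 - 1 / m) ^ k * (2 * D0) + \<epsilon> / 2)" for k
  proof (induction k)
    case 0
    show ?case
    proof (intro exI[of _ "[id]"] conjI ballI allI impI)
      fix t x and x' :: "real ^ 'n" assume "t \<in> I" "x \<in> K" "norm x = norm x'"
      then have "norm (f t x) \<le> D0" "norm (f t x') \<le> D0" using D0[of "(t, x)"] D0[of "(t, x')"] K(2)[of x x'] by auto
      then show "avg [id] (f t) x - avg [id] (f t) x' \<le> (1 - 1 / m) ^ 0 * (2 * D0) + \<epsilon> / 2"
        using \<epsilon> by (simp add: avg_def)
    qed (auto simp: orthogonal_transformation_id)
  next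
    case (Suc k)
    define o' where "o' = (1 - 1 / m) ^ k * (2 * D0) + \<epsilon> / 2"
    obtain Rs where Rs: "Rs \<noteq> []" "\<forall>R\<in>set Rs. orthogonal_transformation R"
      and osc: "\<And>t x x'. t \<in> I \<Longrightarrow> x \<in> K \<Longrightarrow> norm x = norm x' \<Longrightarrow> avg Rs (f t) x - avg Rs (f t) x' \<le> o'"
      using Suc unfolding o'_def by blast
    define Ts where "Ts = concat (map (\<lambda>R. map (\<lambda>S. S \<circ> R) Rs) L)"
    have avgT: "avg Ts g = avg L (avg Rs g)" for g by (rule ext) (simp only: Ts_def avg_avg)
    have "avg Ts (f t) x - avg Ts (f t) x' \<le> (1 - 1 / m) ^ Suc k * (2 * D0) + \<epsilon> / 2"
      if t: "t \<in> I" and x: "x \<in> K" and n: "norm x = norm x'" for t x x'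
    proof -
      define g where "g = avg Rs (f t)"
      have "continuous_on (I \<times> K) (\<lambda>p. avg Rs (f (fst p)) (snd p))"
        by (rule continuous_on_avg[OF cont _ K(2)]) (use Rs(2) in auto)
      then have "continuous_on (sphere 0 (norm x)) (\<lambda>y. avg Rs (f (fst (t, y))) (snd (t, y)))"
        by (rule continuous_on_compose2) (use t x K(2) in \<open>auto intro!: continuous_intros\<close>)
      then have "continuous_on (sphere 0 (norm x)) g" by (simp add: g_def)
      moreover have "x \<in> sphere 0 (norm x)" by simp
      ultimately obtain z where z: "norm z = norm x" "\<And>y. norm y = norm x \<Longrightarrow> g z \<le> g y"
        using continuous_attains_inf[of "sphere 0 (norm x)" g] by fastforce
      have zK: "z \<in> K" using K(2)[OF x z(1)] .
      \<comment> \<open>Orthogonal maps preserve distances, so averaging keeps the modulus of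
        continuity of \<open>f\<close> and the same \<delta> serves every \<open>k\<close>.\<close>
      have near: "g y \<le> g z + \<epsilon> / 2" if y: "norm y = norm x" "norm (y - z) < \<delta>" for y
      proof -
        have "avg Rs (f t) y \<le> avg Rs (\<lambda>x. f t x + \<epsilon> / 2) z"
        proof (rule avg_mono)
          fix R assume "R \<in> set Rs"
          then have ot: "orthogonal_transformation R" using Rs(2) by blast
          have "norm (R y) = norm x" "norm (R z) = norm x"
            using y(1) z(1) orthogonal_transformation_norm[OF ot] by simp_all
          then have "R y \<in> K" "R z \<in> K" by (simp_all add: K(2)[OF x])
          moreover have "dist (t, R y) (t, R z) < \<delta>"
            using y(2) orthogonal_transformation_norm[OF ot, of "y - z"]
            by (simp add: dist_Pair_Pair dist_norm linear_diff[OF orthogonal_transformation_linear[OF ot]])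
          ultimately have "dist (f t (R y)) (f t (R z)) < \<epsilon> / 2"
            using \<delta>(2)[of "(t, R z)" "(t, R y)"] t by simp
          then show "f t (R y) \<le> f t (R z) + \<epsilon> / 2" unfolding dist_real_def by linarith
        qed
        also have "\<dots> = avg Rs (f t) z + \<epsilon> / 2"
          using Rs(1) by (simp add: avg_def sum_list_addf sum_list_triv add_divide_distrib)
        finally show ?thesis by (simp add: g_def)
      qed
      obtain S where S: "S \<in> set L" "norm (S x - z) < \<delta>" using L(3)[of x z] z(1) r[OF x] by auto
      \<comment> \<open>On the sphere \<open>g\<close> is at most its minimum plus
        \<open>o'\<close>, and the map \<open>S\<close> brings \<open>x\<close> next to the minimum
        point \<open>z\<close>, where the bound improves by
        \<open>o' - \<epsilon> / 2\<close>.\<close>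
      have "avg L g x \<le> (g z + o') - (o' - \<epsilon> / 2) / real (length L)"
      proof (rule avg_le_improved[OF _ S(1)])
        fix R assume "R \<in> set L"
        then have "norm (R x) = norm x" using L(2) orthogonal_transformation_norm by blast
        then show "g (R x) \<le> g z + o'"
          using osc[OF t, of "R x" z] K(2)[OF x, of "R x"] z(1) by (simp add: g_def)
      next
        have "norm (S x) = norm x" using S(1) L(2) orthogonal_transformation_norm by blast
        then show "g (S x) \<le> g z + o' - (o' - \<epsilon> / 2)" using near[OF _ S(2)] by simp
      qed
      moreover have "g z \<le> avg L g x'"
        by (rule avg_ge[OF L(1)]) (use z(2) L(2) n orthogonal_transformation_norm in metis)
      ultimately have "avg Ts (f t) x - avg Ts (f t) x' \<le> o' - (o' - \<epsilon> / 2) / m"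
        unfolding avgT g_def[symmetric] m_def by simp
      also have "\<dots> = (1 - 1 / m) ^ Suc k * (2 * D0) + \<epsilon> / 2"
        by (simp add: o'_def algebra_simps)
      finally show ?thesis .
    qed
    moreover have "Ts \<noteq> []" using L(1) Rs(1) by (cases L; cases Rs) (auto simp: Ts_def)
    moreover have "\<forall>R\<in>set Ts. orthogonal_transformation R"
      using L(2) Rs(2) by (auto simp: Ts_def orthogonal_transformation_compose)
    ultimately show ?case by blast
  qed
  have "(\<lambda>k. (1 - 1 / m) ^ k * (2 * D0)) \<longlonglongrightarrow> 0 * (2 * D0)"
    using m by (intro tendsto_mult tendsto_const LIMSEQ_realpow_zero) auto
  then have "\<forall>\<^sub>F k in sequentially. (1 - 1 / m) ^ k * (2 * D0) < \<epsilon> / 2"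
    using \<epsilon> by (intro order_tendstoD) auto
  then obtain k where k: "(1 - 1 / m) ^ k * (2 * D0) < \<epsilon> / 2"
    by (auto simp: eventually_sequentially)
  obtain Rs where "Rs \<noteq> []" "\<forall>R\<in>set Rs. orthogonal_transformation R"
    "\<And>t x x'. t \<in> I \<Longrightarrow> x \<in> K \<Longrightarrow> norm x = norm x' \<Longrightarrow>
        avg Rs (f t) x - avg Rs (f t) x' \<le> (1 - 1 / m) ^ k * (2 * D0) + \<epsilon> / 2"
    using step[of k] by blast
  with k show thesis by (intro that[of Rs]) fastforce+
qed

section \<open>Positive supersolutions\<close>

lemma continuous_on_norm_powr:
  "q > 0 \<Longrightarrow> continuous_on A (\<lambda>x::'a::real_normed_vector. norm x powr q)"
  by (intro continuous_on_powr' continuous_intros) auto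

lemma compact_shell:
  fixes \<phi> :: "'a::euclidean_space \<Rightarrow> real"
  assumes "continuous_on UNIV \<phi>" "\<And>x. \<phi> x \<le> u \<Longrightarrow> norm x \<le> B"
  shows "compact {x. l \<le> \<phi> x \<and> \<phi> x \<le> u}"
proof (rule compact_eq_bounded_closed[THEN iffD2, OF conjI])
  show "bounded {x. l \<le> \<phi> x \<and> \<phi> x \<le> u}"
    unfolding bounded_iff using assms(2) by blast
  show "closed {x. l \<le> \<phi> x \<and> \<phi> x \<le> u}"
    by (intro closed_Collect_conj closed_Collect_le assms(1) continuous_intros)
qed

lemma interior_shell:
  fixes \<phi> :: "'a::euclidean_space \<Rightarrow> real"
  assumes "continuous_on UNIV \<phi>" "l < \<phi> x" "\<phi> x < u"
  shows "x \<in> interior {x. l \<le> \<phi> x \<and> \<phi> x \<le> u}"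
proof (rule interiorI)
  show "open {x. l < \<phi> x \<and> \<phi> x < u}"
    by (intro open_Collect_conj open_Collect_less assms(1) continuous_intros)
qed (use assms in auto)

lemma compact_shell_powr:
  assumes "q > 0"
  shows "compact {x::'a::euclidean_space. l \<le> norm x powr q \<and> norm x powr q \<le> u}"
proof (rule compact_shell)
  show "continuous_on UNIV (\<lambda>x::'a. norm x powr q)" using assms by (rule continuous_on_norm_powr)
  fix x :: 'a assume "norm x powr q \<le> u"
  then have "(norm x powr q) powr (1 / q) \<le> u powr (1 / q)"
    using assms by (intro powr_mono2) auto
  then show "norm x \<le> u powr (1 / q)" using assms by (simp add: powr_powr)
qed

text \<open>The loss of the travelling bump per \<open>y\<^sup>2\<close> in the exponent: the
  damping sufficient for \<open>y \<ge> 1\<close> and a speed of at most \<open>2 * y / T\<close>,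
  accumulated over the time \<open>T / 2\<close>.\<close>

definition decay_rate :: "real \<Rightarrow> real \<Rightarrow> real \<Rightarrow> real" where
  "decay_rate a N T = (30 * a + 12 * (2 / T + \<bar>a / 2 + N - 2\<bar>))\<^sup>2 * T / (192 * a)"

text \<open>A bump of width \<open>1\<close> in the variable \<open>|x|\<^bsup>a/2\<^esup>\<close>, started around \<open>y + 1/2\<close>, is moved to the
  unit sphere in time \<open>T/2\<close>; it loses only a factor \<open>exp (C y\<^sup>2)\<close> on the way.\<close>

lemma supersolution_small_somewhere:
  fixes S :: "real \<Rightarrow> 'a::euclidean_space \<Rightarrow> real"
  assumes "a > 0" "T > 0" "y \<ge> 1"
    and cont: "continuous_on ({0..T / 2} \<times> - {0}) (\<lambda>p. S (fst p) (snd p))"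
    and super: "\<And>t x. 0 < t \<Longrightarrow> t \<le> T / 2 \<Longrightarrow> x \<noteq> 0 \<Longrightarrow> subcal (heat_coeff a) (\<lambda>t x. - S t x) t x"
    and nonneg: "\<And>t x. 0 \<le> t \<Longrightarrow> t \<le> T / 2 \<Longrightarrow> x \<noteq> 0 \<Longrightarrow> S t x \<ge> 0"
    and unit: "\<And>x. norm x = 1 \<Longrightarrow> S (T / 2) x \<le> M"
  obtains x where "y \<le> norm x powr (a / 2)" "norm x powr (a / 2) \<le> y + 1"
    "S 0 x \<le> (M + 1) * exp (decay_rate a (real DIM('a)) T * y\<^sup>2)"
proof -
  define N where "N = real DIM('a)"
  define C where "C = decay_rate a N T"
  \<comment> \<open>With this initial height the bump still has the value \<open>M + 1\<close> when
    its centre reaches the unit sphere.\<close>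
  define M' where "M' = (M + 1) * exp (C * y\<^sup>2)"
  define \<omega> where "\<omega> = 2 / T + \<bar>a / 2 + N - 2\<bar>"
  define \<Lambda> where "\<Lambda> = (30 * a + 12 * \<omega>)\<^sup>2 * y\<^sup>2 / (96 * a)"
  \<comment> \<open>The centre travels from \<open>y + 1 / 2\<close> to \<open>1\<close> in time
    \<open>T / 2\<close>; since the half-width is \<open>1 / 2\<close>, the set where the bump is
    positive stays in the interior of \<open>K\<close>.\<close>
  define v where "v = (2 * y - 1) / T"
  define K where "K = {x::'a. 1 / 2 \<le> norm x powr (a / 2) \<and> norm x powr (a / 2) \<le> y + 1}"
  define \<beta> where "\<beta> t x = exp (- \<Lambda> * t) * (1 - (2 * (norm x powr (a / 2) - (y + 1 / 2 - v * t)))\<^sup>2) ^ 3" for t and x :: 'a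
  have \<omega>: "\<omega> > 0" using assms(2) by (simp add: \<omega>_def add_pos_nonneg)
  have \<Lambda>T: "\<Lambda> * (T / 2) = C * y\<^sup>2"
    by (simp add: \<Lambda>_def C_def decay_rate_def \<omega>_def)
  have K0: "x \<noteq> 0" if "x \<in> K" for x using that by (auto simp: K_def)
  have M: "M \<ge> 0"
  proof -
    obtain e :: 'a where e: "e \<in> Basis" using nonempty_Basis by blast
    then have "norm e = 1" "e \<noteq> 0" by auto
    with unit[of e] nonneg[of "T / 2" e] assms(2) show ?thesis by simp
  qed
  have "\<exists>x. y \<le> norm x powr (a / 2) \<and> norm x powr (a / 2) \<le> y + 1 \<and> S 0 x \<le> M'"
  proof (rule ccontr)
    assume "\<not> (\<exists>x. y \<le> norm x powr (a / 2) \<and> norm x powr (a / 2) \<le> y + 1 \<and> S 0 x \<le> M')"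
    then have large: "S 0 x \<ge> M'" if "y \<le> norm x powr (a / 2)" "norm x powr (a / 2) \<le> y + 1" for x
      using that by force
    \<comment> \<open>No positive part is taken in \<open>\<beta>\<close>: outside the bump the cube
      is nonpositive, and the maximum principle ignores such points.\<close>
    have supp: "M' * \<beta> t x \<le> 0 \<or> (1 - (2 * (norm x powr (a / 2) - (y + 1 / 2 - v * t)))\<^sup>2 > 0 \<and>
        \<bar>norm x powr (a / 2) - (y + 1 / 2 - v * t)\<bar> < 1 / 2)" for t x
    proof (cases "1 - (2 * (norm x powr (a / 2) - (y + 1 / 2 - v * t)))\<^sup>2 > 0")
      case True
      moreover have "\<bar>w\<bar> < 1 / 2" if "1 - (2 * w)\<^sup>2 > 0" for w :: real
        using that abs_square_less_1[of "2 * w"] by auto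
      ultimately show ?thesis by blast
    next
      case False
      then have "(1 - (2 * (norm x powr (a / 2) - (y + 1 / 2 - v * t)))\<^sup>2) ^ 3 \<le> 0"
        by (intro power_le_zero_eq[THEN iffD2]) auto
      then show ?thesis using M by (auto simp: \<beta>_def M'_def mult_nonneg_nonpos)
    qed
    have range: "0 \<le> v * t" "v * t \<le> y - 1 / 2" if "0 \<le> t" "t \<le> T / 2" for t
    proof -
      have v: "v \<ge> 0" using assms(2,3) by (simp add: v_def)
      then show "0 \<le> v * t" using that by simp
      have "v * t \<le> v * (T / 2)" using v that by (intro mult_left_mono)
      also have "\<dots> = y - 1 / 2" using assms(2) by (simp add: v_def field_simps)
      finally show "v * t \<le> y - 1 / 2" .
    qed
    have le: "M' * \<beta> t x - S t x \<le> 0" if "t \<in> {0..T / 2}" "x \<in> K" for t x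
    proof (rule parabolic_maximum_principle[where F="\<lambda>t x. M' * \<beta> t x - S t x" and c="heat_coeff a", OF _ _ _ _ that])
      show "compact K" unfolding K_def using assms(1) by (intro compact_shell_powr) auto
      have "{0..T / 2} \<times> K \<subseteq> {0..T / 2} \<times> - {0}" using K0 by auto
      then have "continuous_on ({0..T / 2} \<times> K) (\<lambda>p. S (fst p) (snd p))"
        by (rule continuous_on_subset[OF cont])
      then show "continuous_on ({0..T / 2} \<times> K) (\<lambda>p. M' * \<beta> (fst p) (snd p) - S (fst p) (snd p))"
        unfolding \<beta>_def by (intro continuous_intros) (use K0 in auto)
    next
      fix x assume x: "x \<in> K"
      have nn: "S 0 x \<ge> 0" using nonneg[of 0 x] K0[OF x] assms(2) by simp
      show "M' * \<beta> 0 x - S 0 x \<le> 0"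
      proof (cases "M' * \<beta> 0 x \<le> 0")
        case False
        define q where "q = (2 * (norm x powr (a / 2) - (y + 1 / 2)))\<^sup>2"
        have *: "1 - q > 0" "\<bar>norm x powr (a / 2) - (y + 1 / 2)\<bar> < 1 / 2"
          using supp[of 0 x] False by (auto simp: q_def)
        then have "S 0 x \<ge> M'" by (intro large) linarith+
        moreover have "(1 - q) ^ 3 \<le> 1" using *(1) by (intro power_le_one) (auto simp: q_def)
        then have "M' * \<beta> 0 x \<le> M' * 1"
          using M by (intro mult_left_mono) (auto simp: \<beta>_def q_def M'_def)
        ultimately show ?thesis by simp
      qed (use nn in simp)
    next
      fix t x assume t: "0 < t" "t \<le> T / 2" and x: "x \<in> K" and pos: "M' * \<beta> t x - S t x > 0"
      have nn: "S t x \<ge> 0" using nonneg[of t x] K0[OF x] t by simp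
      then have p: "1 - (2 * (norm x powr (a / 2) - (y + 1 / 2 - v * t)))\<^sup>2 > 0"
        "\<bar>norm x powr (a / 2) - (y + 1 / 2 - v * t)\<bar> < 1 / 2"
        using supp[of t x] pos by auto
      have ge: "1 / 2 < norm x powr (a / 2)" "norm x powr (a / 2) < y + 1"
        using p(2) range[of t] t by linarith+
      have "x \<in> interior K" unfolding K_def
        by (rule interior_shell) (use ge assms(1) in \<open>auto intro: continuous_on_norm_powr\<close>)
      moreover have "subcal (heat_coeff a) \<beta> t x"
        unfolding \<beta>_def
      proof (rule subcal_travelling_bump[OF assms(1) K0[OF x] _ _ _ p(1)])
        have "v \<le> 2 * y / T" "v \<ge> 0" using assms(2,3) by (auto simp: v_def divide_right_mono)
        moreover have "\<bar>a / 2 + N - 2\<bar> \<le> \<bar>a / 2 + N - 2\<bar> * y" using assms(3) mult_left_mono[of 1 y "\<bar>a / 2 + N - 2\<bar>"] by simp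
        ultimately show "\<bar>v\<bar> + \<bar>a / 2 + real DIM('a) - 2\<bar> \<le> \<omega> * y"
          by (simp add: \<omega>_def N_def[symmetric] algebra_simps)
        have "30 * a + 12 * (\<omega> * y) \<le> (30 * a + 12 * \<omega>) * y"
          using mult_left_mono[OF assms(3), of "30 * a"] assms(1) by (simp add: algebra_simps)
        then have "(30 * a + 12 * (\<omega> * y))\<^sup>2 \<le> ((30 * a + 12 * \<omega>) * y)\<^sup>2"
          using assms(1,3) \<omega> by (intro power_mono) auto
        also have "\<dots> = 96 * a * \<Lambda>" using assms(1) by (simp add: \<Lambda>_def power_mult_distrib)
        finally show "(30 * a + 12 * (\<omega> * y))\<^sup>2 \<le> 96 * a * \<Lambda>" .
      qed (use ge in simp)
      then have "subcal (heat_coeff a) (\<lambda>t x. M' * \<beta> t x + - S t x) t x"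
        using M by (intro subcal_add subcal_cmult super t K0[OF x]) (auto simp: M'_def)
      ultimately show "x \<in> interior K \<and> subcal (heat_coeff a) (\<lambda>t x. M' * \<beta> t x - S t x) t x \<and> heat_coeff a x \<ge> 0"
        using heat_coeff_nonneg[OF assms(1)] by simp
    qed
    obtain e :: 'a where e: "e \<in> Basis" using nonempty_Basis by blast
    then have ne: "norm e = 1" by simp
    have "v * T = 2 * y - 1" using assms(2) by (simp add: v_def)
    then have z: "norm e powr (a / 2) - (y + 1 / 2 - v * (T / 2)) = 0" by (simp add: ne field_simps)
    have "\<beta> (T / 2) e = exp (- (C * y\<^sup>2))" unfolding \<beta>_def z using \<Lambda>T by simp
    then have "M' * \<beta> (T / 2) e = M + 1" by (simp add: M'_def exp_minus field_simps)
    moreover have "e \<in> K" using assms(3) by (simp add: K_def ne)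
    ultimately show False using le[of "T / 2" e] unit[OF ne] assms(2) by auto
  qed
  then show thesis using that unfolding M'_def C_def N_def by blast
qed

text \<open>Discrete form of the substitution of \<open>\<tau> - t\<close> for \<open>t\<close> in
  an integral over \<open>[0, \<tau>]\<close>. The backward samples need not lie on the grid, but
  those at nonnegative times are within \<open>h\<close> of distinct grid points, and those at
  negative times vanish.\<close>

lemma sum_shifted_le:
  fixes g s :: "real \<Rightarrow> real"
  assumes h: "h > 0" and \<tau>: "0 \<le> \<tau>" "\<tau> \<le> real n * h"
    and neg: "\<And>t. t < 0 \<Longrightarrow> g t = 0"
    and le: "\<And>t t'. 0 \<le> t \<Longrightarrow> t \<le> real n * h \<Longrightarrow> 0 \<le> t' \<Longrightarrow> t' \<le> real n * h \<Longrightarrow> \<bar>t - t'\<bar> \<le> h \<Longrightarrow> g t \<le> s t' + \<epsilon>"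
    and nonneg: "\<And>t. 0 \<le> t \<Longrightarrow> t \<le> real n * h \<Longrightarrow> s t + \<epsilon> \<ge> 0"
  shows "(\<Sum>i\<le>n. g (\<tau> - real i * h)) \<le> (\<Sum>i\<le>n. s (real i * h) + \<epsilon>)"
proof -
  define k where "k = nat \<lfloor>\<tau> / h\<rfloor>"
  have k: "real k * h \<le> \<tau>" "\<tau> < (real k + 1) * h"
  proof -
    have "real k = of_int \<lfloor>\<tau> / h\<rfloor>" using h \<tau> by (simp add: k_def)
    then have "real k \<le> \<tau> / h" "\<tau> / h < real k + 1" by linarith+
    then show "real k * h \<le> \<tau>" "\<tau> < (real k + 1) * h" using h by (simp_all add: field_simps)
  qed
  have "real k * h \<le> real n * h" using k \<tau> by linarith
  then have kn: "k \<le> n" using h by simp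
  have "(\<Sum>i\<le>n. g (\<tau> - real i * h)) = (\<Sum>i\<le>k. g (\<tau> - real i * h))"
  proof (rule sum.mono_neutral_right)
    show "\<forall>i\<in>{..n} - {..k}. g (\<tau> - real i * h) = 0"
    proof
      fix i assume "i \<in> {..n} - {..k}"
      then have "real k + 1 \<le> real i" by auto
      then have "(real k + 1) * h \<le> real i * h" using h by (intro mult_right_mono) auto
      then show "g (\<tau> - real i * h) = 0" using k by (intro neg) linarith
    qed
  qed (use kn in auto)
  also have "\<dots> \<le> (\<Sum>i\<le>k. s (real (k - i) * h) + \<epsilon>)"
  proof (rule sum_mono)
    fix i assume "i \<in> {..k}"
    then have i: "real (k - i) * h = real k * h - real i * h" "real i * h \<le> real k * h" "0 \<le> real i * h"
      using h by (auto simp: of_nat_diff algebra_simps)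
    have "real k * h \<le> real n * h" using kn h by simp
    then show "g (\<tau> - real i * h) \<le> s (real (k - i) * h) + \<epsilon>"
      using i k \<tau> distrib_right[of "real k" 1 h] by (intro le) linarith+
  qed
  also have "\<dots> = (\<Sum>i\<le>k. s (real i * h) + \<epsilon>)"
    by (rule sum.reindex_bij_witness[of _ "\<lambda>i. k - i" "\<lambda>i. k - i"]) auto
  also have "\<dots> \<le> (\<Sum>i\<le>n. s (real i * h) + \<epsilon>)"
  proof (rule sum_mono2)
    fix i assume "i \<in> {..n} - {..k}"
    then have "real i * h \<le> real n * h" "0 \<le> real i * h" using h by auto
    then show "0 \<le> s (real i * h) + \<epsilon>" by (intro nonneg)
  qed (use kn in auto)
  finally show ?thesis .
qed

text \<open>The average of \<open>S\<close> over rotations and time is bounded by \<open>exp (C y\<^sup>2)\<close> on some sphere in each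
  shell \<open>y \<le> |x|\<^bsup>a/2\<^esup> \<le> y + 1\<close>, and it dominates the corresponding average of \<open>G\<close>. As \<open>y\<close> tends to
  infinity, that growth is too slow for a nonzero subsolution.\<close>

lemma dominated_subsolution_short_time:
  fixes S G :: "real \<Rightarrow> real ^ 'n \<Rightarrow> real"
  assumes a: "a > 0" "a + real CARD('n) - 2 > 0" and T: "T > 0"
    and S_cont: "continuous_on ({0..T} \<times> - {0}) (\<lambda>p. S (fst p) (snd p))"
    and S_super: "\<And>t x. 0 < t \<Longrightarrow> t \<le> T \<Longrightarrow> x \<noteq> 0 \<Longrightarrow> subcal (heat_coeff a) (\<lambda>t x. - S t x) t x"
    and S_nonneg: "\<And>t x. 0 \<le> t \<Longrightarrow> t \<le> T \<Longrightarrow> x \<noteq> 0 \<Longrightarrow> S t x \<ge> 0"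
    and G_cont: "continuous_on ({..T} \<times> - {0}) (\<lambda>p. G (fst p) (snd p))"
    and G_sub: "\<And>t x. t \<le> T \<Longrightarrow> x \<noteq> 0 \<Longrightarrow> subcal (heat_coeff a) G t x"
    and G_nonneg: "\<And>t x. G t x \<ge> 0"
    and G_le: "\<And>t x. 0 \<le> t \<Longrightarrow> t \<le> T \<Longrightarrow> x \<noteq> 0 \<Longrightarrow> G t x \<le> S t x"
    and G_init: "\<And>t x. t \<le> \<alpha> \<Longrightarrow> G t x = 0"
    and G_core: "\<And>t x. t \<le> T \<Longrightarrow> norm x \<le> \<epsilon> \<Longrightarrow> G t x = 0" "\<epsilon> > 0"
    and t: "0 \<le> \<alpha>" "\<alpha> < \<beta>" "\<beta> \<le> T / 2"
      "\<beta> \<le> \<alpha> + 1 / (4 * a * (decay_rate a (real CARD('n)) T + 1))"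
    and low: "\<rho> > 0" "\<gamma> > 0" "0 < \<delta>" "\<delta> \<le> T / 2"
      "\<And>t x. \<beta> - \<delta> \<le> t \<Longrightarrow> t \<le> \<beta> \<Longrightarrow> norm x = \<rho> \<Longrightarrow> G t x \<ge> \<gamma>"
  shows False
proof -
  define C where "C = decay_rate a (real CARD('n)) T"
  define b where "b = a + real CARD('n) - 2"
  \<comment> \<open>A rate above \<open>C\<close> makes the barrier outgrow
    \<open>exp (C * y\<^sup>2)\<close>; the excess \<open>1\<close> leaves the factor
    \<open>exp (y\<^sup>2)\<close> to absorb all constants.\<close>
  define \<kappa> where "\<kappa> = C + 1"
  \<comment> \<open>\<mu> and \<sigma> give equality in the two conditions of
    \<open>subcal_neg_exp_barrier\<close>; the barrier then serves for the time
    \<open>1 / \<mu>\<close>, which is the assumed bound on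
    \<open>\<beta> - \<alpha>\<close>.\<close>
  define \<mu> where "\<mu> = 4 * a * \<kappa>"
  define \<sigma> where "\<sigma> = 2 * b / \<mu>"
  define B where "B t x = exp (\<kappa> * (1 + \<mu> * (t - \<alpha>)) * (norm x powr a + \<sigma>))" for t and x :: "real ^ 'n"
  \<comment> \<open>So small that \<open>\<eta> * B\<close> at time \<beta> on the sphere of radius
    \<rho> is at most half of the lower bound \<open>\<delta> * \<gamma>\<close> found for
    \<open>Q\<close> at the end.\<close>
  define \<eta> where "\<eta> = \<delta> * \<gamma> / (2 * exp (\<kappa> * 2 * (\<rho> powr a + \<sigma>)))"
  have C: "C \<ge> 0" using a T by (simp add: C_def decay_rate_def)
  have \<kappa>: "\<kappa> > 0" using C by (simp add: \<kappa>_def)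
  have \<mu>: "\<mu> > 0" using a \<kappa> by (simp add: \<mu>_def)
  have \<sigma>: "\<sigma> > 0" "\<mu> * \<sigma> = 2 * b" using a \<mu> by (auto simp: \<sigma>_def b_def)
  have \<eta>: "\<eta> > 0" using low by (simp add: \<eta>_def)
  have \<mu>t: "0 \<le> \<mu> * (t - \<alpha>)" "\<mu> * (t - \<alpha>) \<le> 1" if "\<alpha> \<le> t" "t \<le> \<beta>" for t
  proof -
    show "0 \<le> \<mu> * (t - \<alpha>)" using \<mu> that by simp
    have "t - \<alpha> \<le> 1 / \<mu>" using t(4) that by (simp add: \<mu>_def \<kappa>_def C_def)
    then show "\<mu> * (t - \<alpha>) \<le> 1" using \<mu> by (simp add: field_simps)
  qed

  have "compact ({0..T} \<times> sphere (0::real ^ 'n) 1)" by (intro compact_Times) auto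
  moreover have "continuous_on ({0..T} \<times> sphere (0::real ^ 'n) 1) (\<lambda>p. S (fst p) (snd p))"
    by (rule continuous_on_subset[OF S_cont]) auto
  ultimately have "bounded ((\<lambda>p. S (fst p) (snd p)) ` ({0..T} \<times> sphere (0::real ^ 'n) 1))"
    by (intro compact_imp_bounded compact_continuous_image)
  then obtain M where "M > 0" and M_abs: "\<And>p. p \<in> {0..T} \<times> sphere (0::real ^ 'n) 1 \<Longrightarrow> norm (S (fst p) (snd p)) \<le> M"
    unfolding bounded_pos by blast
  have M: "S t x \<le> M" if "0 \<le> t" "t \<le> T" "norm x = 1" for t x
    using M_abs[of "(t, x)"] that by auto

  \<comment> \<open>The logarithm gives \<open>y_large\<close>, and the term with \<rho> puts the
    shell outside the sphere of radius \<rho>. The rotations and the time mesh depend on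
    \<open>y\<close> through \<open>K\<close>; fixing \<open>y\<close> before them is possible
    because \<open>M\<close> bounds every average of \<open>S\<close> on the unit sphere.\<close>
  define y where "y = 1 + \<rho> powr (a / 2) + \<bar>ln ((T * M + 3) / \<eta>)\<bar>"
  have y: "y \<ge> 1" "y > \<rho> powr (a / 2)" by (auto simp: y_def add_pos_nonneg)
  have TM: "T * M > 0" using T \<open>M > 0\<close> by simp
  have y_large: "(T * M + 1) * exp (C * y\<^sup>2) + 2 \<le> \<eta> * exp (\<kappa> * y\<^sup>2)"
  proof -
    have "ln ((T * M + 3) / \<eta>) \<le> y"
      using abs_ge_self[of "ln ((T * M + 3) / \<eta>)"] powr_ge_zero[of \<rho> "a / 2"] unfolding y_def by linarith
    also have "\<dots> \<le> y\<^sup>2" using y(1) by (simp add: power2_eq_square)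
    finally have "exp (ln ((T * M + 3) / \<eta>)) \<le> exp (y\<^sup>2)" by simp
    moreover have "(T * M + 3) / \<eta> > 0" using TM \<eta> by simp
    ultimately have "(T * M + 3) / \<eta> \<le> exp (y\<^sup>2)" by (metis exp_ln)
    then have "T * M + 3 \<le> \<eta> * exp (y\<^sup>2)" using \<eta> by (simp add: pos_divide_le_eq mult.commute)
    then have "(T * M + 3) * exp (C * y\<^sup>2) \<le> \<eta> * exp (y\<^sup>2) * exp (C * y\<^sup>2)" by (intro mult_right_mono) auto
    also have "\<dots> = \<eta> * exp (\<kappa> * y\<^sup>2)" by (simp add: \<kappa>_def algebra_simps exp_add)
    finally have "(T * M + 3) * exp (C * y\<^sup>2) \<le> \<eta> * exp (\<kappa> * y\<^sup>2)" .
    moreover have "exp (C * y\<^sup>2) \<ge> 1" using C by simp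
    ultimately show ?thesis unfolding distrib_right by linarith
  qed

  define K where "K = {x::real ^ 'n. 1 / 2 \<le> norm x powr (a / 2) \<and> norm x powr (a / 2) \<le> y + 1}"
  have K: "compact K" unfolding K_def using a by (intro compact_shell_powr) auto
  have K0: "x \<noteq> 0" if "x \<in> K" for x using that by (auto simp: K_def)
  have Kn: "x' \<in> K" if "x \<in> K" "norm x' = norm x" for x x' using that by (auto simp: K_def)
  have S_contK: "continuous_on ({0..T} \<times> K) (\<lambda>p. S (fst p) (snd p))"
    by (rule continuous_on_subset[OF S_cont]) (use K0 in auto)
  have T': "1 / T > 0" using T by simp
  \<comment> \<open>A tolerance of \<open>1 / T\<close> costs at most \<open>1\<close> after
    summation over the time window, because \<open>h * (real n + 1) \<le> T\<close>.\<close>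
  obtain Rs where Rs: "Rs \<noteq> []" "\<And>R. R \<in> set Rs \<Longrightarrow> orthogonal_transformation R"
    and osc: "\<And>t x x'. t \<in> {0..T} \<Longrightarrow> x \<in> K \<Longrightarrow> norm x = norm x' \<Longrightarrow> avg Rs (S t) x - avg Rs (S t) x' \<le> 1 / T"
  proof (rule almost_radial_avg[OF S_contK compact_Icc K Kn T'])
    fix Rs
    assume "Rs \<noteq> []" "\<And>R. R \<in> set Rs \<Longrightarrow> orthogonal_transformation R"
      "\<And>t x x'. t \<in> {0..T} \<Longrightarrow> x \<in> K \<Longrightarrow> norm x = norm x' \<Longrightarrow> avg Rs (S t) x - avg Rs (S t) x' \<le> 1 / T"
    then show thesis by (rule that)
  qed
  have nR: "norm (R x) = norm x" if "R \<in> set Rs" for R x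
    using orthogonal_transformation_norm[OF Rs(2)[OF that]] .
  have R0: "R x \<noteq> 0" if "R \<in> set Rs" "x \<noteq> 0" for R x
    using nR[OF that(1), of x] that(2) by (metis norm_eq_zero)
  have "uniformly_continuous_on ({0..T} \<times> K) (\<lambda>p. S (fst p) (snd p))"
    using S_contK K by (intro compact_uniformly_continuous compact_Times) auto
  then obtain d where d: "d > 0" and unif: "\<And>p q. p \<in> {0..T} \<times> K \<Longrightarrow> q \<in> {0..T} \<times> K \<Longrightarrow> dist q p < d \<Longrightarrow>
      dist (S (fst q) (snd q)) (S (fst p) (snd p)) < 1 / T"
    using T' unfolding uniformly_continuous_on_def by blast
  define n where "n = nat \<lceil>T / d\<rceil> + 1"
  define h where "h = T / (2 * real n)"
  have n: "n \<ge> 1" by (simp add: n_def)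
  have h: "h > 0" "real n * h = T / 2" using T n by (auto simp: h_def)
  have "T / d < real n" by (simp add: n_def) linarith
  then have "T < real n * d" using d by (simp add: field_simps)
  also have "\<dots> \<le> 2 * real n * d" using d by simp
  finally have hd: "h < d" using n by (simp add: h_def field_simps)
  have ih: "0 \<le> real i * h" "real i * h \<le> T / 2" if "i \<le> n" for i
  proof -
    show "0 \<le> real i * h" using h by simp
    have "real i * h \<le> real n * h" using h that by (intro mult_right_mono) auto
    then show "real i * h \<le> T / 2" using h by simp
  qed
  have hn: "h * (real n + 1) \<le> T"
  proof -
    have "h * (real n + 1) \<le> h * (2 * real n)" using h n by (intro mult_left_mono) auto
    also have "\<dots> = T" using h(2) by (simp add: mult.commute)
    finally show ?thesis .
  qed
  have sum_le: "h * (\<Sum>i\<le>n. f i) \<le> T * m" if "\<And>i. i \<le> n \<Longrightarrow> f i \<le> m" "m \<ge> 0" for f :: "nat \<Rightarrow> real" and m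
  proof -
    have "(\<Sum>i\<le>n. f i) \<le> (\<Sum>i\<le>n. m)" using that by (intro sum_mono) auto
    then have "h * (\<Sum>i\<le>n. f i) \<le> h * (\<Sum>i\<le>n. m)" using h by (intro mult_left_mono) auto
    also have "\<dots> = h * (real n + 1) * m" by (simp add: algebra_simps)
    also have "\<dots> \<le> T * m" using hn that(2) by (rule mult_right_mono)
    finally show ?thesis .
  qed

  \<comment> \<open>Riemann sums over the coming window for \<open>S\<close> and over the past
    window for \<open>G\<close>. Only time shifts and nonnegative combinations occur, so the
    differential inequalities survive.\<close>
  define \<Sigma> where "\<Sigma> t x = h * (\<Sum>i\<le>n. avg Rs (S (t + real i * h)) x)" for t x
  define Q where "Q t x = h * (\<Sum>i\<le>n. avg Rs (G (t - real i * h)) x)" for t x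
  have S_avg_cont: "continuous_on ({0..T} \<times> - {0}) (\<lambda>p. avg Rs (S (fst p)) (snd p))"
    by (rule continuous_on_avg[OF S_cont Rs(2)]) auto
  have G_avg_cont: "continuous_on ({..T} \<times> - {0}) (\<lambda>p. avg Rs (G (fst p)) (snd p))"
    by (rule continuous_on_avg[OF G_cont Rs(2)]) auto
  have S_avg_nonneg: "avg Rs (S t) x \<ge> 0" if "0 \<le> t" "t \<le> T" "x \<noteq> 0" for t x
    by (rule avg_ge[OF Rs(1)]) (use that S_nonneg R0 in auto)
  have \<Sigma>_cont: "continuous_on ({0..T / 2} \<times> - {0}) (\<lambda>p. \<Sigma> (fst p) (snd p))"
    unfolding \<Sigma>_def
  proof (intro continuous_intros)
    fix i assume "i \<in> {..n}"
    then show "continuous_on ({0..T / 2} \<times> - {0}) (\<lambda>p. avg Rs (S (fst p + real i * h)) (snd p))"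
      using ih[of i]
      by (intro continuous_on_compose2[OF S_avg_cont, of _ "\<lambda>p. (fst p + real i * h, snd p)", unfolded fst_conv snd_conv]
          continuous_intros) auto
  qed
  have \<Sigma>_super: "subcal (heat_coeff a) (\<lambda>t x. - \<Sigma> t x) t x" if t: "0 < t" "t \<le> T / 2" and x: "x \<noteq> 0" for t x
  proof -
    have "subcal (heat_coeff a) (\<lambda>t x. h * (\<Sum>i\<le>n. avg Rs (\<lambda>x. - S (t + real i * h) x) x)) t x"
    proof (intro subcal_cmult subcal_sum)
      fix i assume "i \<in> {..n}"
      then have i: "0 < t + real i * h" "t + real i * h \<le> T" using ih[of i] t by auto
      have "subcal (heat_coeff a) (\<lambda>t. avg Rs (\<lambda>x. - S t x)) (t + real i * h) x"
        by (rule subcal_avg[OF Rs(2)]) (use S_super[OF i] R0 x in \<open>auto simp: heat_coeff_def\<close>)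
      then show "subcal (heat_coeff a) (\<lambda>t. avg Rs (\<lambda>x. - S (t + real i * h) x)) t x"
        by (rule subcal_shift[where f="\<lambda>t. avg Rs (\<lambda>x. - S t x)"])
    qed (use h in simp)
    then show ?thesis by (simp add: \<Sigma>_def avg_uminus sum_negf)
  qed
  have "\<exists>x. y \<le> norm x powr (a / 2) \<and> norm x powr (a / 2) \<le> y + 1 \<and>
      \<Sigma> 0 x \<le> (T * M + 1) * exp (decay_rate a (real DIM(real ^ 'n)) T * y\<^sup>2)"
  proof (rule supersolution_small_somewhere[OF a(1) T y(1) \<Sigma>_cont])
    show "subcal (heat_coeff a) (\<lambda>t x. - \<Sigma> t x) t x" if "0 < t" "t \<le> T / 2" "x \<noteq> 0" for t x
      using \<Sigma>_super that .
    show "\<Sigma> t x \<ge> 0" if "0 \<le> t" "t \<le> T / 2" "x \<noteq> 0" for t x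
      unfolding \<Sigma>_def
    proof (intro mult_nonneg_nonneg sum_nonneg S_avg_nonneg)
      fix i assume "i \<in> {..n}"
      then show "0 \<le> t + real i * h" "t + real i * h \<le> T" using ih[of i] that by auto
    qed (use h that in auto)
    show "\<Sigma> (T / 2) x \<le> T * M" if "norm x = 1" for x
      unfolding \<Sigma>_def
    proof (rule sum_le)
      fix i assume "i \<le> n"
      then have "0 \<le> T / 2 + real i * h" "T / 2 + real i * h \<le> T" using ih[of i] T by auto
      then show "avg Rs (S (T / 2 + real i * h)) x \<le> M"
        by (intro avg_le[OF Rs(1)] M) (use nR that in auto)
    qed (use \<open>M > 0\<close> in simp)
  qed blast
  then obtain x' where x': "y \<le> norm x' powr (a / 2)" "norm x' powr (a / 2) \<le> y + 1"
    "\<Sigma> 0 x' \<le> (T * M + 1) * exp (C * y\<^sup>2)"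
    by (auto simp: C_def)
  define r where "r = norm x'"
  have x'K: "x' \<in> K" using x' y by (simp add: K_def)
  have r: "r > 0" using K0[OF x'K] by (simp add: r_def)
  have rK: "x \<in> K" if "norm x = r" for x using Kn[OF x'K] that by (simp add: r_def)
  have r1r: "\<rho> < r"
  proof (rule ccontr)
    assume "\<not> \<rho> < r"
    then have "r powr (a / 2) \<le> \<rho> powr (a / 2)" using r a by (intro powr_mono2) auto
    then show False using x'(1) y(2) by (simp add: r_def)
  qed
  have \<Sigma>_r: "\<Sigma> 0 x \<le> (T * M + 1) * exp (C * y\<^sup>2) + 1" if "norm x = r" for x
  proof -
    have "\<Sigma> 0 x - \<Sigma> 0 x' = h * (\<Sum>i\<le>n. avg Rs (S (0 + real i * h)) x - avg Rs (S (0 + real i * h)) x')"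
      by (simp add: \<Sigma>_def sum_subtractf right_diff_distrib)
    also have "\<dots> \<le> T * (1 / T)"
    proof (rule sum_le)
      fix i assume "i \<le> n"
      then have "0 + real i * h \<in> {0..T}" using ih[of i] T by auto
      then show "avg Rs (S (0 + real i * h)) x - avg Rs (S (0 + real i * h)) x' \<le> 1 / T"
        by (rule osc) (use rK that in \<open>auto simp: r_def\<close>)
    qed (use T in simp)
    finally show ?thesis using x'(3) T by simp
  qed
  \<comment> \<open>One sphere serves all \<tau>: the past samples of \<open>G\<close> are dominated
    by the samples of \<open>S\<close> over the fixed window that starts at time
    \<open>0\<close>.\<close>
  have Q_r: "Q \<tau> x \<le> (T * M + 1) * exp (C * y\<^sup>2) + 2" if x: "norm x = r" and \<tau>: "0 \<le> \<tau>" "\<tau> \<le> T / 2" for x \<tau>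
  proof -
    have x0: "x \<noteq> 0" using x r by auto
    have "(\<Sum>i\<le>n. avg Rs (G (\<tau> - real i * h)) x) \<le> (\<Sum>i\<le>n. avg Rs (S (real i * h)) x + 1 / T)"
    proof (rule sum_shifted_le[where g="\<lambda>t. avg Rs (G t) x" and s="\<lambda>t. avg Rs (S t) x"])
      show "avg Rs (G t) x = 0" if "t < 0" for t
        using that G_init[of t] t(1) by (simp add: avg_def)
      show "avg Rs (S s) x + 1 / T \<ge> 0" if "0 \<le> s" "s \<le> real n * h" for s
        using S_avg_nonneg[of s x] x0 that h T by simp
      show "avg Rs (G s) x \<le> avg Rs (S s') x + 1 / T"
        if s: "0 \<le> s" "s \<le> real n * h" "0 \<le> s'" "s' \<le> real n * h" "\<bar>s - s'\<bar> \<le> h" for s s'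
      proof -
        have sT: "0 \<le> s" "s \<le> T" "0 \<le> s'" "s' \<le> T" using s h T by auto
        have "avg Rs (G s) x \<le> avg Rs (\<lambda>x. S s' x + 1 / T) x"
        proof (rule avg_mono)
          fix R assume R: "R \<in> set Rs"
          have "R x \<in> K" using rK nR[OF R] x by simp
          moreover have "dist (s, R x) (s', R x) < d" using s(5) hd by (simp add: dist_Pair_Pair dist_real_def)
          ultimately have "dist (S s (R x)) (S s' (R x)) < 1 / T"
            using unif[of "(s', R x)" "(s, R x)"] sT by simp
          then have "S s (R x) \<le> S s' (R x) + 1 / T" unfolding dist_real_def by linarith
          with G_le[OF sT(1,2) R0[OF R x0]] show "G s (R x) \<le> S s' (R x) + 1 / T" by linarith
        qed
        also have "\<dots> = avg Rs (S s') x + 1 / T"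
          using Rs(1) by (simp add: avg_def sum_list_addf sum_list_triv add_divide_distrib)
        finally show ?thesis .
      qed
    qed (use h \<tau> in auto)
    then have "Q \<tau> x \<le> h * (\<Sum>i\<le>n. avg Rs (S (real i * h)) x + 1 / T)"
      unfolding Q_def using h by (intro mult_left_mono) auto
    also have "\<dots> = \<Sigma> 0 x + h * (\<Sum>i\<le>n. 1 / T)"
      by (simp add: \<Sigma>_def sum.distrib algebra_simps)
    also have "h * (\<Sum>i\<le>n. 1 / T) \<le> T * (1 / T)" by (rule sum_le) (use T in auto)
    finally show ?thesis using \<Sigma>_r[OF x] T by simp
  qed

  define D where "D = {x::real ^ 'n. \<epsilon> \<le> norm x \<and> norm x \<le> r}"
  have D0: "x \<noteq> 0" if "x \<in> D" for x using that G_core(2) by (auto simp: D_def)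
  \<comment> \<open>Comparison on an annulus: \<open>Q\<close> vanishes on the inner sphere by
    \<open>G_core\<close>, and on the outer one \<open>Q_r\<close> and \<open>y_large\<close> put
    \<open>Q\<close> below the barrier.\<close>
  have Q_B: "Q t x - \<eta> * B t x \<le> 0" if "t \<in> {\<alpha>..\<beta>}" "x \<in> D" for t x
  proof (rule parabolic_maximum_principle[where F="\<lambda>t x. Q t x - \<eta> * B t x" and c="heat_coeff a", OF _ _ _ _ that])
    show "compact D" unfolding D_def by (rule compact_shell[where B=r]) (auto intro: continuous_intros)
    have "continuous_on ({\<alpha>..\<beta>} \<times> D) (\<lambda>p. Q (fst p) (snd p))"
      unfolding Q_def
    proof (intro continuous_intros)
      fix i assume "i \<in> {..n}"
      then show "continuous_on ({\<alpha>..\<beta>} \<times> D) (\<lambda>p. avg Rs (G (fst p - real i * h)) (snd p))"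
        using ih[of i] t T D0
        by (intro continuous_on_compose2[OF G_avg_cont, of _ "\<lambda>p. (fst p - real i * h, snd p)", unfolded fst_conv snd_conv]
            continuous_intros) auto
    qed
    then show "continuous_on ({\<alpha>..\<beta>} \<times> D) (\<lambda>p. Q (fst p) (snd p) - \<eta> * B (fst p) (snd p))"
      unfolding B_def by (intro continuous_intros) (use D0 in auto)
  next
    fix x assume "x \<in> D"
    have "avg Rs (G (\<alpha> - real i * h)) x = 0" for i
      using G_init[of "\<alpha> - real i * h"] h by (simp add: avg_def)
    then show "Q \<alpha> x - \<eta> * B \<alpha> x \<le> 0" using \<eta> by (simp add: Q_def B_def)
  next
    fix s x assume s: "\<alpha> < s" "s \<le> \<beta>" and x: "x \<in> D" and pos: "Q s x - \<eta> * B s x > 0"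
    have x0: "x \<noteq> 0" using D0[OF x] .
    have iT: "s - real i * h \<le> T" for i
    proof -
      have "0 \<le> real i * h" using h by simp
      then show ?thesis using s t T by linarith
    qed
    have B: "\<eta> * B s x > 0" using \<eta> by (simp add: B_def)
    have "norm x \<noteq> \<epsilon>"
    proof
      assume "norm x = \<epsilon>"
      then have "avg Rs (G (s - real i * h)) x = avg Rs (\<lambda>_. 0) x" for i
        unfolding avg_def using G_core(1)[OF iT[of i]] nR
        by (intro arg_cong[where f="\<lambda>z. z / _"] arg_cong[where f=sum_list] map_cong) auto
      then have "Q s x = 0" by (simp add: Q_def avg_const[OF Rs(1)])
      then show False using pos B by simp
    qed
    moreover have "norm x \<noteq> r"
    proof
      assume nx: "norm x = r"
      have "y\<^sup>2 \<le> (norm x powr (a / 2))\<^sup>2" using x'(1) y(1) nx by (intro power_mono) (auto simp: r_def)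
      also have "\<dots> = norm x powr a" using x0 by (simp add: power2_eq_square powr_add[symmetric])
      also have "\<dots> \<le> norm x powr a + \<sigma>" using \<sigma> by simp
      also have "\<dots> \<le> (1 + \<mu> * (s - \<alpha>)) * (norm x powr a + \<sigma>)"
        using \<mu>t(1)[of s] s \<sigma> by (simp add: distrib_right add_nonneg_pos less_imp_le)
      finally have "\<kappa> * y\<^sup>2 \<le> \<kappa> * ((1 + \<mu> * (s - \<alpha>)) * (norm x powr a + \<sigma>))"
        using \<kappa> by (intro mult_left_mono) auto
      then have "exp (\<kappa> * y\<^sup>2) \<le> B s x" by (simp add: B_def mult.assoc)
      then have "\<eta> * exp (\<kappa> * y\<^sup>2) \<le> \<eta> * B s x" using \<eta> by (intro mult_left_mono) auto
      moreover have "Q s x \<le> (T * M + 1) * exp (C * y\<^sup>2) + 2" by (rule Q_r[OF nx]) (use s t in auto)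
      ultimately show False using pos y_large by linarith
    qed
    ultimately have "\<epsilon> < norm x" "norm x < r" using x by (auto simp: D_def)
    then have "x \<in> interior D" unfolding D_def
      by (intro interior_shell) (auto intro: continuous_intros)
    moreover have "subcal (heat_coeff a) (\<lambda>t x. Q t x + \<eta> * - B t x) s x"
    proof (rule subcal_add)
      show "subcal (heat_coeff a) Q s x"
        unfolding Q_def
      proof (intro subcal_cmult subcal_sum)
        fix i assume "i \<in> {..n}"
        have "subcal (heat_coeff a) (\<lambda>t. avg Rs (G t)) (s + - (real i * h)) x"
          by (rule subcal_avg[OF Rs(2)]) (use G_sub[of "s - real i * h"] iT[of i] R0 x0 in \<open>auto simp: heat_coeff_def\<close>)
        from subcal_shift[OF this]
        show "subcal (heat_coeff a) (\<lambda>t. avg Rs (G (t - real i * h))) s x" by simp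
      qed (use h in simp)
      have "subcal (heat_coeff a) (\<lambda>t x. - B t x) s x"
        unfolding B_def
        by (rule subcal_neg_exp_barrier) (use a \<kappa> x0 \<sigma>(2) \<mu>t[of s] s in \<open>auto simp: \<mu>_def b_def\<close>)
      then show "subcal (heat_coeff a) (\<lambda>t x. \<eta> * - B t x) s x" using \<eta> by (intro subcal_cmult) auto
    qed
    ultimately show "x \<in> interior D \<and> subcal (heat_coeff a) (\<lambda>t x. Q t x - \<eta> * B t x) s x \<and> heat_coeff a x \<ge> 0"
      using heat_coeff_nonneg[OF a(1)] by simp
  qed

  define x1 where "x1 = \<rho> *\<^sub>R (axis undefined 1 :: real ^ 'n)"
  have x1: "norm x1 = \<rho>" using low(1) by (simp add: x1_def)
  have G1: "avg Rs (G s) x1 \<ge> \<gamma>" if "\<beta> - \<delta> \<le> s" "s \<le> \<beta>" for s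
    by (rule avg_ge[OF Rs(1)]) (use low(5)[OF that] nR x1 in auto)
  have "\<epsilon> < \<rho>"
  proof (rule ccontr)
    assume "\<not> \<epsilon> < \<rho>"
    then have "G \<beta> x1 = 0" using x1 t T by (intro G_core) auto
    with low(5)[of \<beta> x1] low x1 show False by simp
  qed
  then have "x1 \<in> D" using x1 r1r by (simp add: D_def)
  with Q_B[of \<beta> x1] t have up: "Q \<beta> x1 \<le> \<eta> * B \<beta> x1" by simp
  have "B \<beta> x1 \<le> exp (\<kappa> * 2 * (\<rho> powr a + \<sigma>))"
    unfolding B_def x1 exp_le_cancel_iff
    by (intro mult_right_mono mult_left_mono) (use \<mu>t[of \<beta>] t \<kappa> \<sigma> in auto)
  then have "\<eta> * B \<beta> x1 \<le> \<eta> * exp (\<kappa> * 2 * (\<rho> powr a + \<sigma>))" using \<eta> by (intro mult_left_mono) auto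
  also have "\<dots> = \<delta> * \<gamma> / 2" by (simp add: \<eta>_def)
  finally have small: "Q \<beta> x1 \<le> \<delta> * \<gamma> / 2" using up by simp
  \<comment> \<open>The samples \<open>0\<close> to \<open>m\<close> lie in the time window of
    length \<delta> on which \<open>G\<close> is at least \<gamma>; counting the one at \<beta>
    itself there are \<open>m + 1\<close>, of total weight at least \<delta>.\<close>
  define m where "m = nat \<lfloor>\<delta> / h\<rfloor>"
  have m: "real m * h \<le> \<delta>" "\<delta> \<le> h * (real m + 1)"
  proof -
    have "real m = of_int \<lfloor>\<delta> / h\<rfloor>" using h low by (simp add: m_def)
    then have "real m \<le> \<delta> / h" "\<delta> / h \<le> real m + 1" by linarith+
    then show "real m * h \<le> \<delta>" "\<delta> \<le> h * (real m + 1)" using h by (simp_all add: field_simps)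
  qed
  have "real m * h \<le> real n * h" using m(1) low(4) h(2) by linarith
  then have mn: "m \<le> n" using h(1) by simp
  have "\<delta> * \<gamma> \<le> h * (real m + 1) * \<gamma>" using m(2) low by (intro mult_right_mono) auto
  also have "\<dots> = h * (\<Sum>i\<le>m. \<gamma>)" by (simp add: algebra_simps)
  also have "\<dots> \<le> h * (\<Sum>i\<le>m. avg Rs (G (\<beta> - real i * h)) x1)"
  proof (intro mult_left_mono sum_mono G1)
    fix i assume "i \<in> {..m}"
    then have "real i * h \<le> real m * h" using h by (intro mult_right_mono) auto
    then show "\<beta> - \<delta> \<le> \<beta> - real i * h" using m by simp
  qed (use h in auto)
  also have "\<dots> \<le> h * (\<Sum>i\<le>n. avg Rs (G (\<beta> - real i * h)) x1)"
    using mn h G_nonneg by (intro mult_left_mono sum_mono2 avg_ge[OF Rs(1)]) auto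
  finally have "\<delta> * \<gamma> \<le> Q \<beta> x1" by (simp add: Q_def)
  with small low show False by (smt (verit) mult_pos_pos field_sum_of_halves)
qed

text \<open>The short-time result needs a lower bound on a whole sphere, but a nonzero
  \<open>G\<close> gives one only near a point. Averaging over a net of orthogonal maps spreads it:
  some map carries any given point of the sphere near \<open>x1\<close>. The step length
  \<open>\<tau>\<close> depends only on \<open>a\<close>, the dimension and \<open>T\<close>, so
  finitely many steps reach \<open>T / 2\<close>.\<close>

lemma dominated_subsolution_zero:
  fixes S G :: "real \<Rightarrow> real ^ 'n \<Rightarrow> real"
  assumes a: "a > 0" "a + real CARD('n) - 2 > 0" and T: "T > 0"
    and S_cont: "continuous_on ({0..T} \<times> - {0}) (\<lambda>p. S (fst p) (snd p))"
    and S_super: "\<And>t x. 0 < t \<Longrightarrow> t \<le> T \<Longrightarrow> x \<noteq> 0 \<Longrightarrow> subcal (heat_coeff a) (\<lambda>t x. - S t x) t x"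
    and S_nonneg: "\<And>t x. 0 \<le> t \<Longrightarrow> t \<le> T \<Longrightarrow> x \<noteq> 0 \<Longrightarrow> S t x \<ge> 0"
    and G_cont: "continuous_on ({..T} \<times> - {0}) (\<lambda>p. G (fst p) (snd p))"
    and G_sub: "\<And>t x. t \<le> T \<Longrightarrow> x \<noteq> 0 \<Longrightarrow> subcal (heat_coeff a) G t x"
    and G_nonneg: "\<And>t x. G t x \<ge> 0"
    and G_le: "\<And>t x. 0 \<le> t \<Longrightarrow> t \<le> T \<Longrightarrow> x \<noteq> 0 \<Longrightarrow> G t x \<le> S t x"
    and G_init: "\<And>t x. t \<le> 0 \<Longrightarrow> G t x = 0"
    and G_core: "\<And>t x. t \<le> T \<Longrightarrow> norm x \<le> r0 \<Longrightarrow> G t x = 0" "r0 > 0"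
    and t: "t \<le> T / 2"
  shows "G t x = 0"
proof -
  define \<tau> where "\<tau> = 1 / (4 * a * (decay_rate a (real CARD('n)) T + 1))"
  have "decay_rate a (real CARD('n)) T \<ge> 0" using a T by (simp add: decay_rate_def)
  then have \<tau>: "\<tau> > 0" using a by (simp add: \<tau>_def)
  have step: "G t1 x1 = 0" if zero: "\<And>t x. t \<le> t0 \<Longrightarrow> G t x = 0" and t0: "t0 \<ge> 0"
    and t1: "t1 \<le> t0 + \<tau>" "t1 \<le> T / 2" for t0 t1 x1
  proof (rule ccontr)
    assume "G t1 x1 \<noteq> 0"
    then have pos: "G t1 x1 > 0" using G_nonneg[of t1 x1] by simp
    have "t0 < t1" using zero[of t1 x1] pos by force
    have "r0 < norm x1" using G_core(1)[of t1 x1] pos t1 T by force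
    then have x1: "x1 \<noteq> 0" using G_core(2) by auto
    define g where "g = G t1 x1 / 2"
    have "(t1, x1) \<in> {..T} \<times> - {0}" using t1 T x1 by auto
    with G_cont pos obtain d where d: "d > 0" and near: "\<And>p. p \<in> {..T} \<times> - {0} \<Longrightarrow> dist p (t1, x1) < d \<Longrightarrow>
        dist (G (fst p) (snd p)) (G t1 x1) < g"
      unfolding continuous_on_iff g_def by (metis fst_conv snd_conv half_gt_zero)
    obtain L :: "(real ^ 'n \<Rightarrow> real ^ 'n) list" where L: "L \<noteq> []"
      "\<And>R. R \<in> set L \<Longrightarrow> orthogonal_transformation R"
      "\<And>x x'. norm x = norm x' \<Longrightarrow> norm x \<le> norm x1 \<Longrightarrow> \<exists>R\<in>set L. norm (R x - x') < d / 2"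
      using rotation_net[of "d / 2" "norm x1"] d by (metis half_gt_zero)
    have nR: "norm (R x) = norm x" if "R \<in> set L" for R x
      using orthogonal_transformation_norm[OF L(2)[OF that]] .
    have R0: "R x \<noteq> 0" if "R \<in> set L" "x \<noteq> 0" for R x
      using nR[OF that(1), of x] that(2) by (metis norm_eq_zero)
    have zero_avg: "avg L f x = 0" if "\<And>R. R \<in> set L \<Longrightarrow> f (R x) = 0" for f x
      by (rule antisym; rule avg_le[OF L(1)] avg_ge[OF L(1)]) (simp_all add: that)
    show False
    \<comment> \<open>Deviations of \<open>d / 3\<close> in time and \<open>d / 2\<close> in space
      stay within the distance \<open>d\<close> on which \<open>G\<close> is at least
      \<open>g\<close>. One such term among \<open>length L\<close> nonnegative ones gives the lower
      bound.\<close>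
    proof (rule dominated_subsolution_short_time[where S="\<lambda>t. avg L (S t)" and G="\<lambda>t. avg L (G t)" and
          \<alpha>=t0 and \<beta>=t1 and \<epsilon>=r0 and \<rho>="norm x1" and \<gamma>="g / real (length L)" and \<delta>="min (d / 3) (T / 2)", OF a T])
      show "continuous_on ({0..T} \<times> - {0}) (\<lambda>p. avg L (S (fst p)) (snd p))"
        by (rule continuous_on_avg[OF S_cont L(2)]) auto
      show "continuous_on ({..T} \<times> - {0}) (\<lambda>p. avg L (G (fst p)) (snd p))"
        by (rule continuous_on_avg[OF G_cont L(2)]) auto
      show "subcal (heat_coeff a) (\<lambda>t x. - avg L (S t) x) t x" if "0 < t" "t \<le> T" "x \<noteq> 0" for t x
        unfolding avg_uminus[symmetric]
        by (rule subcal_avg[OF L(2)]) (use S_super[OF that(1,2)] R0 that(3) in \<open>auto simp: heat_coeff_def\<close>)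
      show "subcal (heat_coeff a) (\<lambda>t. avg L (G t)) t x" if "t \<le> T" "x \<noteq> 0" for t x
        by (rule subcal_avg[OF L(2)]) (use G_sub[OF that(1)] R0 that(2) in \<open>auto simp: heat_coeff_def\<close>)
      show "avg L (S t) x \<ge> 0" if "0 \<le> t" "t \<le> T" "x \<noteq> 0" for t x
        by (rule avg_ge[OF L(1)]) (use S_nonneg that R0 in auto)
      show "avg L (G t) x \<ge> 0" for t x
        by (rule avg_ge[OF L(1)]) (rule G_nonneg)
      show "avg L (G t) x \<le> avg L (S t) x" if "0 \<le> t" "t \<le> T" "x \<noteq> 0" for t x
        by (rule avg_mono) (use G_le that R0 in auto)
      show "avg L (G t) x = 0" if "t \<le> t0" for t x
        by (rule zero_avg) (rule zero[OF that])
      show "avg L (G t) x = 0" if "t \<le> T" "norm x \<le> r0" for t x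
        by (rule zero_avg) (rule G_core(1), use nR that in auto)
      show "t1 \<le> t0 + 1 / (4 * a * (decay_rate a (real CARD('n)) T + 1))" using t1(1) by (simp add: \<tau>_def)
      show "g / real (length L) \<le> avg L (G t) x" if t: "t1 - min (d / 3) (T / 2) \<le> t" "t \<le> t1" and x: "norm x = norm x1" for t x
      proof -
        obtain R where R: "R \<in> set L" "norm (R x - x1) < d / 2" using L(3)[of x x1] x by auto
        have "dist (t, R x) (t1, x1) \<le> \<bar>t - t1\<bar> + dist (R x) x1"
          using sqrt_sum_squares_le_sum_abs[of "dist t t1" "dist (R x) x1"]
          by (simp add: dist_Pair_Pair dist_real_def)
        also have "\<dots> < d"
        proof -
          have "\<bar>t - t1\<bar> \<le> d / 3" using t min.cobounded1[of "d / 3" "T / 2"] by linarith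
          then show ?thesis using R(2) d unfolding dist_norm by linarith
        qed
        finally have "dist (t, R x) (t1, x1) < d" .
        moreover have "x \<noteq> 0" using x x1 by (metis norm_eq_zero)
        then have "R x \<noteq> 0" by (rule R0[OF R(1)])
        moreover have "t \<le> T" using t(2) t1(2) T by linarith
        ultimately have "dist (G t (R x)) (G t1 x1) < g" using near[of "(t, R x)"] by simp
        then have "G t (R x) \<ge> g" unfolding dist_real_def g_def by linarith
        then have "avg L (\<lambda>x. - G t x) x \<le> 0 - g / real (length L)"
          by (intro avg_le_improved[OF _ R(1)]) (use G_nonneg in auto)
        then show ?thesis by (simp add: avg_uminus)
      qed
      show "g / real (length L) > 0" using pos L(1) by (simp add: g_def)
      show "0 < min (d / 3) (T / 2)" using d T by simp
      show "norm x1 > 0" using x1 by simp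
    qed (use G_core(2) t0 \<open>t0 < t1\<close> t1(2) in simp_all)
  qed
  have "\<forall>t x. t \<le> real k * \<tau> \<longrightarrow> t \<le> T / 2 \<longrightarrow> G t x = 0" for k
  proof (induction k)
    case (Suc k)
    show ?case
    proof (intro allI impI)
      fix t x assume t: "t \<le> real (Suc k) * \<tau>" "t \<le> T / 2"
      show "G t x = 0"
      proof (cases "real k * \<tau> \<le> T / 2")
        case True
        show ?thesis
        proof (rule step[of "real k * \<tau>"])
          show "G t x = 0" if "t \<le> real k * \<tau>" for t x using Suc.IH that True by simp
          show "t \<le> real k * \<tau> + \<tau>" using t(1) by (simp add: distrib_right)
        qed (use \<tau> t(2) in auto)
      next
        case False
        then show ?thesis using Suc.IH t(2) by simp
      qed
    qed
  qed (use G_init in simp)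
  moreover obtain k where "T / 2 < real k * \<tau>" using reals_Archimedean3[OF \<tau>] by blast
  ultimately show ?thesis using t by (meson order_trans less_imp_le)
qed

section \<open>Solutions with one-sided growth\<close>

lemma DERIV_If_join:
  fixes p q :: "real \<Rightarrow> real"
  assumes p: "(p has_real_derivative D) (at c)" and q: "(q has_real_derivative D) (at c)" and eq: "p c = q c"
  shows "((\<lambda>z. if z \<le> c then p z else q z) has_real_derivative D) (at c)"
  unfolding has_field_derivative_iff
proof (rule filterlim_split_at)
  have "((\<lambda>y. (p y - p c) / (y - c)) \<longlongrightarrow> D) (at_left c)"
    using p unfolding has_field_derivative_iff by (rule tendsto_within_subset) simp
  then show "((\<lambda>y. ((if y \<le> c then p y else q y) - (if c \<le> c then p c else q c)) / (y - c)) \<longlongrightarrow> D) (at_left c)"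
    by (rule Lim_transform_eventually) (auto simp: eventually_at_filter)
  have "((\<lambda>y. (q y - q c) / (y - c)) \<longlongrightarrow> D) (at_right c)"
    using q unfolding has_field_derivative_iff by (rule tendsto_within_subset) simp
  then show "((\<lambda>y. ((if y \<le> c then p y else q y) - (if c \<le> c then p c else q c)) / (y - c)) \<longlongrightarrow> D) (at_right c)"
    by (rule Lim_transform_eventually) (auto simp: eventually_at_filter eq)
qed

text \<open>A convex \<open>C\<^sup>2\<close> substitute for the positive part: sums of subsolutions have to stay twice
  differentiable, and linear growth keeps the result below \<open>S\<close>.\<close>

definition soft_pos :: "real \<Rightarrow> real" where
  "soft_pos z = (if z \<le> 0 then 0 else z - arctan z)"

definition soft_pos' :: "real \<Rightarrow> real" where
  "soft_pos' z = (if z \<le> 0 then 0 else 1 - inverse (1 + z\<^sup>2))"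

definition soft_pos'' :: "real \<Rightarrow> real" where
  "soft_pos'' z = (if z \<le> 0 then 0 else 2 * z * (inverse (1 + z\<^sup>2))\<^sup>2)"

lemma DERIV_piecewise_at_0:
  fixes q q' :: "real \<Rightarrow> real"
  assumes q: "\<And>z. (q has_real_derivative q' z) (at z)" and "q 0 = 0" "q' 0 = 0"
  shows "((\<lambda>z. if z \<le> 0 then 0 else q z) has_real_derivative (if z \<le> 0 then 0 else q' z)) (at z)"
proof -
  consider "z < 0" | "z = 0" | "z > 0" by linarith
  then show ?thesis
  proof cases
    case 1
    then have "((\<lambda>z. if z \<le> 0 then 0 else q z) has_real_derivative 0) (at z)"
      by (intro has_field_derivative_transform_within_open[OF DERIV_const[of 0], where S="{..<0}"]) auto
    then show ?thesis using 1 by simp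
  next
    case 2
    then show ?thesis
      using DERIV_If_join[OF DERIV_const, of q 0 0] q[of 0] assms(2,3) by simp
  next
    case 3
    then show ?thesis
      using has_field_derivative_transform_within_open[OF q[of z], of "{0<..}" "\<lambda>z. if z \<le> 0 then 0 else q z"] by auto
  qed
qed

lemma one_plus_square_neq_0: "1 + z\<^sup>2 \<noteq> (0::real)"
  using zero_le_power2[of z] by linarith

lemma DERIV_soft_pos: "(soft_pos has_real_derivative soft_pos' z) (at z)"
  unfolding soft_pos_def[abs_def] soft_pos'_def
  by (rule DERIV_piecewise_at_0) (auto intro!: derivative_eq_intros simp: one_plus_square_neq_0)

lemma DERIV_soft_pos': "(soft_pos' has_real_derivative soft_pos'' z) (at z)"
  unfolding soft_pos'_def[abs_def] soft_pos''_def
  by (rule DERIV_piecewise_at_0) (auto intro!: derivative_eq_intros simp: one_plus_square_neq_0[unfolded power2_eq_square] power2_eq_square)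

lemma soft_pos''_nonneg: "soft_pos'' z \<ge> 0"
  by (simp add: soft_pos''_def)

lemma soft_pos_pos: "z > 0 \<Longrightarrow> soft_pos z > 0"
proof -
  assume z: "z > 0"
  have "\<exists>s. 0 < s \<and> s < z \<and> soft_pos z - soft_pos 0 = (z - 0) * soft_pos' s"
    by (rule MVT2[OF z]) (rule DERIV_soft_pos)
  then obtain s where s: "0 < s" "soft_pos z = z * soft_pos' s" by (auto simp: soft_pos_def)
  have "inverse (1 + s\<^sup>2) < 1" using s(1) by (simp add: inverse_less_1_iff)
  then have "soft_pos' s > 0" using s(1) by (simp add: soft_pos'_def)
  then show ?thesis using s z by simp
qed

lemma soft_pos_bounds: "0 \<le> soft_pos z" "soft_pos z \<le> max z 0"
  using soft_pos_pos[of z] by (auto simp: soft_pos_def split: if_splits)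

lemma continuous_on_soft_pos: "continuous_on A soft_pos"
  using DERIV_soft_pos by (intro DERIV_continuous_on) (auto intro: has_field_derivative_at_within)

section \<open>Pointwise derivatives and growth of solutions\<close>

lemma a_heat_solution_at:
  fixes g :: "real \<Rightarrow> real ^ 'n \<Rightarrow> real"
  assumes g: "a_heat_solution a g" and t: "t > 0" and x: "x \<noteq> 0"
  shows "\<exists>\<gamma> l. ((\<lambda>s. g s x) has_real_derivative heat_coeff a x * l) (at t) \<and> has_lap (g t) \<gamma> l x"
proof -
  have "(\<lambda>s. g s x) differentiable_on {0..}" using g by (auto simp: a_heat_solution_def C1_in_time_def)
  then have "((\<lambda>s. g s x) has_vector_derivative time_deriv g t x) (at t within {0..})"
    using t unfolding time_deriv_def differentiable_on_def
    by (subst vector_derivative_works[symmetric]) auto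
  moreover have "at t within {0..} = at t" using t by (intro at_within_interior) simp
  ultimately have "((\<lambda>s. g s x) has_real_derivative time_deriv g t x) (at t)"
    by (simp add: has_real_derivative_iff_has_vector_derivative)
  moreover have "time_deriv g t x = heat_coeff a x * laplacian (g t) x"
    using g t x by (simp add: a_heat_solution_def heat_coeff_def)
  moreover have "class_C 2 (UNIV - {0}) (g t)" using g t by (simp add: a_heat_solution_def)
  then have "\<exists>\<gamma>. has_lap (g t) \<gamma> (laplacian (g t) x) x"
    using x by (intro class_C_has_lap) auto
  ultimately show ?thesis by auto
qed

lemma a_heat_solution_subcal:
  assumes "a_heat_solution a g" "t > 0" "x \<noteq> 0"
  shows "subcal (heat_coeff a) g t x"
  using a_heat_solution_at[OF assms] unfolding subcal_def by blast

lemma a_heat_solution_continuous: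
  "a_heat_solution a g \<Longrightarrow> continuous_on ({0..} \<times> UNIV) (\<lambda>p. g (fst p) (snd p))"
  by (simp add: a_heat_solution_def case_prod_unfold)

text \<open>Raise \<open>z \<le> exp z\<close> at \<open>z = \<kappa> * \<rho> / k\<close> to the
  power \<open>k\<close>.\<close>

lemma powr_le_exp:
  fixes k \<kappa> \<rho> :: real
  assumes "k > 0" "\<kappa> > 0" "\<rho> \<ge> 0"
  shows "\<rho> powr k \<le> (k / \<kappa>) powr k * exp (\<kappa> * \<rho>)"
proof -
  have "\<kappa> * \<rho> / k \<le> exp (\<kappa> * \<rho> / k)" using exp_ge_add_one_self[of "\<kappa> * \<rho> / k"] by linarith
  then have "(\<kappa> * \<rho> / k) powr k \<le> exp (\<kappa> * \<rho> / k) powr k"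
    using assms by (intro powr_mono2) auto
  also have "\<dots> = exp (\<kappa> * \<rho>)" using assms by (simp add: powr_def)
  finally have "(k / \<kappa>) powr k * (\<kappa> * \<rho> / k) powr k \<le> (k / \<kappa>) powr k * exp (\<kappa> * \<rho>)"
    by (intro mult_left_mono) auto
  moreover have "(k / \<kappa>) powr k * (\<kappa> * \<rho> / k) powr k = \<rho> powr k"
    using assms by (subst powr_mult[symmetric]) auto
  ultimately show ?thesis by simp
qed

text \<open>Any power of \<open>norm x powr a\<close> is dominated by an exponential of arbitrarily
  small rate, and continuity handles the remaining compact ball. The freedom in
  \<open>\<kappa>\<close> matters because the time for which a barrier serves is inversely
  proportional to its rate.\<close>

lemma a_heat_solution_upper_bound:
  fixes g :: "real \<Rightarrow> real ^ 'n \<Rightarrow> real"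
  assumes g: "a_heat_solution a g" and "T > 0" "\<kappa> > 0"
  obtains A where "A > 0" "\<And>t x. 0 \<le> t \<Longrightarrow> t \<le> T \<Longrightarrow> g t x \<le> A * exp (\<kappa> * norm x powr a)"
proof -
  obtain k R C where k: "k > 0" "C > 0"
    and bd: "\<And>t x. t \<in> {0..T} \<Longrightarrow> norm x > R \<Longrightarrow> g t x \<le> C * (1 + norm x powr (k * a))"
    using g \<open>T > 0\<close> unfolding a_heat_solution_def growth_bound_def by metis
  have "compact ({0..T} \<times> cball (0::real ^ 'n) R)" by (intro compact_Times) auto
  moreover have "continuous_on ({0..T} \<times> cball (0::real ^ 'n) R) (\<lambda>p. g (fst p) (snd p))"
    by (rule continuous_on_subset[OF a_heat_solution_continuous[OF g]]) auto
  ultimately have "bounded ((\<lambda>p. g (fst p) (snd p)) ` ({0..T} \<times> cball (0::real ^ 'n) R))"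
    by (intro compact_imp_bounded compact_continuous_image)
  then obtain M where "M > 0" and M: "\<And>p. p \<in> {0..T} \<times> cball (0::real ^ 'n) R \<Longrightarrow> norm (g (fst p) (snd p)) \<le> M"
    unfolding bounded_pos by blast
  define q where "q = (k / \<kappa>) powr k"
  define A where "A = M + C * (1 + q)"
  have q: "q \<ge> 0" by (simp add: q_def)
  have "A > 0" using \<open>M > 0\<close> k q by (simp add: A_def add_pos_nonneg)
  moreover have "g t x \<le> A * exp (\<kappa> * norm x powr a)" if t: "0 \<le> t" "t \<le> T" for t x
  proof -
    define e where "e = exp (\<kappa> * norm x powr a)"
    have e: "e \<ge> 1" using \<open>\<kappa> > 0\<close> by (simp add: e_def)
    show ?thesis unfolding e_def[symmetric]
    proof (cases "norm x > R")
      case True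
      have "norm x powr (k * a) = (norm x powr a) powr k" by (simp add: powr_powr mult.commute)
      also have "\<dots> \<le> q * e" unfolding q_def e_def using k \<open>\<kappa> > 0\<close> by (intro powr_le_exp) auto
      finally have "C * (1 + norm x powr (k * a)) \<le> C * (e + q * e)"
        using e k by (intro mult_left_mono) auto
      also have "\<dots> \<le> A * e" using \<open>M > 0\<close> e by (simp add: A_def algebra_simps)
      finally show "g t x \<le> A * e" using bd[of t x] True t by simp
    next
      case False
      then have "g t x \<le> M" using M[of "(t, x)"] t by simp
      also have "\<dots> \<le> A" using k q by (simp add: A_def)
      also have "\<dots> \<le> A * e" using \<open>A > 0\<close> e by simp
      finally show "g t x \<le> A * e" .
    qed
  qed
  ultimately show thesis by (rule that)
qed

lemma a_heat_solution_le:
  fixes u v :: "real \<Rightarrow> real ^ 'n \<Rightarrow> real"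
  assumes a: "a > 0" "a + real CARD('n) - 2 > 0"
    and u: "a_heat_solution a u" and v: "a_heat_solution a v"
    and init: "\<And>x. u 0 x = v 0 x" and origin: "\<And>t. t \<ge> 0 \<Longrightarrow> u t 0 = v t 0"
    and t: "t > 0"
  shows "u t x \<le> v t x"
proof (rule field_le_epsilon)
  fix \<delta> :: real assume \<delta>: "\<delta> > 0"
  \<comment> \<open>The comparison lemma reaches only half of its time interval, hence
    \<open>T = 2 * t\<close>. The choice of \<open>\<kappa>\<close> gives
    \<open>4 * a * \<kappa> = 1 / T\<close>, so that the barrier with \<open>\<mu> = 1 / T\<close>
    serves on all of \<open>[0, T]\<close>; \<open>\<sigma>\<close> then meets the second barrier
    condition with equality.\<close>
  define T where "T = 2 * t"
  define \<kappa> where "\<kappa> = 1 / (4 * a * T)"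
  define \<sigma> where "\<sigma> = 2 * (a + real CARD('n) - 2) * T"
  have T: "T > 0" using t by (simp add: T_def)
  have \<kappa>: "\<kappa> > 0" using a T by (simp add: \<kappa>_def)
  have \<sigma>: "\<sigma> > 0" using a T by (simp add: \<sigma>_def)
  obtain A1 where A1: "A1 > 0" "\<And>t x. 0 \<le> t \<Longrightarrow> t \<le> T \<Longrightarrow> u t x \<le> A1 * exp (\<kappa> * norm x powr a)"
    by (rule a_heat_solution_upper_bound[OF u T \<kappa>]) blast
  obtain A2 where A2: "A2 > 0" "\<And>t x. 0 \<le> t \<Longrightarrow> t \<le> T \<Longrightarrow> v t x \<le> A2 * exp (\<kappa> * norm x powr a)"
    by (rule a_heat_solution_upper_bound[OF v T \<kappa>]) blast
  define P where "P s x = (A1 + A2) * exp (\<kappa> * (1 + 1 / T * (s - 0)) * (norm x powr a + \<sigma>))" for s and x :: "real ^ 'n"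
  have uP: "u s x \<le> P s x" and vP: "v s x \<le> P s x" if s: "0 \<le> s" "s \<le> T" for s x
  proof -
    have "norm x powr a \<le> norm x powr a + \<sigma>" using \<sigma> by simp
    also have "\<dots> \<le> (1 + 1 / T * (s - 0)) * (norm x powr a + \<sigma>)"
      using s T \<sigma> by (simp add: distrib_right)
    finally have "\<kappa> * norm x powr a \<le> \<kappa> * (1 + 1 / T * (s - 0)) * (norm x powr a + \<sigma>)"
      using \<kappa> by (simp add: mult.assoc)
    then have e: "exp (\<kappa> * norm x powr a) \<le> exp (\<kappa> * (1 + 1 / T * (s - 0)) * (norm x powr a + \<sigma>))" by simp
    have "A1 * exp (\<kappa> * norm x powr a) \<le> P s x" "A2 * exp (\<kappa> * norm x powr a) \<le> P s x"
      unfolding P_def using A1(1) A2(1) e by (intro mult_mono; simp)+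
    then show "u s x \<le> P s x" "v s x \<le> P s x"
      using A1(2)[OF s, of x] A2(2)[OF s, of x] by auto
  qed
  \<comment> \<open>Freezing time below zero makes \<open>w\<close> vanish there. As \<delta> is
    subtracted, at each point \<open>G\<close> also vanishes shortly after time zero, so the
    one-sided derivative at \<open>0\<close> never enters.\<close>
  define w where "w s x = u (max 0 s) x - v (max 0 s) x" for s x
  define S where "S s x = 2 * P s x - u s x - v s x" for s x
  define G where "G s x = soft_pos (w s x - \<delta>)" for s x
  have clamp: "continuous_on UNIV (\<lambda>p. g (max 0 (fst p)) (snd p))" if "a_heat_solution a g"
    for g :: "real \<Rightarrow> real ^ 'n \<Rightarrow> real"
    by (rule continuous_on_compose2[OF a_heat_solution_continuous[OF that], of _ "\<lambda>p. (max 0 (fst p), snd p)", unfolded fst_conv snd_conv])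
      (auto intro!: continuous_intros)
  have w_cont: "continuous_on UNIV (\<lambda>p. w (fst p) (snd p))"
    unfolding w_def by (intro continuous_on_diff clamp u v)
  have w0: "w s x = 0" if "s \<le> 0 \<or> x = 0" for s x
    using that init origin[of "max 0 s"] by (auto simp: w_def max_def)
  \<comment> \<open>Agreement at the origin enters here: \<open>w\<close> vanishes on the axis
    \<open>x = 0\<close> and is uniformly continuous near it.\<close>
  obtain r0 where r0: "r0 > 0" "\<And>s x. 0 \<le> s \<Longrightarrow> s \<le> T \<Longrightarrow> norm x \<le> r0 \<Longrightarrow> w s x \<le> \<delta>"
  proof -
    have "uniformly_continuous_on ({0..T} \<times> cball (0::real ^ 'n) 1) (\<lambda>p. w (fst p) (snd p))"
      by (intro compact_uniformly_continuous compact_Times continuous_on_subset[OF w_cont]) auto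
    then obtain d where d: "d > 0" "\<And>p q. p \<in> {0..T} \<times> cball (0::real ^ 'n) 1 \<Longrightarrow> q \<in> {0..T} \<times> cball (0::real ^ 'n) 1 \<Longrightarrow>
        dist q p < d \<Longrightarrow> dist (w (fst q) (snd q)) (w (fst p) (snd p)) < \<delta>"
      using \<delta> unfolding uniformly_continuous_on_def by blast
    have "w s x \<le> \<delta>" if "0 \<le> s" "s \<le> T" "norm x \<le> min 1 (d / 2)" for s x
      using d(2)[of "(s, 0)" "(s, x)"] that d(1) w0[of s 0]
      by (auto simp: dist_Pair_Pair dist_real_def)
    then show thesis using that[of "min 1 (d / 2)"] d(1) by auto
  qed
  have "G t x = 0"
  proof (rule dominated_subsolution_zero[OF a T, where S=S and G=G])
    have "continuous_on ({0..T} \<times> - {0}) (\<lambda>p. u (fst p) (snd p))" "continuous_on ({0..T} \<times> - {0}) (\<lambda>p. v (fst p) (snd p))"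
      by (auto intro: continuous_on_subset[OF a_heat_solution_continuous[OF u]]
          continuous_on_subset[OF a_heat_solution_continuous[OF v]])
    then show "continuous_on ({0..T} \<times> - {0}) (\<lambda>p. S (fst p) (snd p))"
      unfolding S_def P_def by (intro continuous_intros) (use T in auto)
    show "subcal (heat_coeff a) (\<lambda>t x. - S t x) s y" if s: "0 < s" "s \<le> T" and y: "y \<noteq> 0" for s y
    proof -
      have "subcal (heat_coeff a) (\<lambda>t x. (2 * (A1 + A2)) * - exp (\<kappa> * (1 + 1 / T * (t - 0)) * (norm x powr a + \<sigma>))
          + u t x + v t x) s y"
        by (intro subcal_add subcal_cmult subcal_neg_exp_barrier a_heat_solution_subcal[OF u] a_heat_solution_subcal[OF v])
          (use a T \<kappa> y s A1(1) A2(1) in \<open>auto simp: \<kappa>_def \<sigma>_def\<close>)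
      moreover have "(2 * (A1 + A2)) * - exp (\<kappa> * (1 + 1 / T * (t - 0)) * (norm x powr a + \<sigma>)) + u t x + v t x = - S t x" for t x
        by (simp add: S_def P_def algebra_simps)
      ultimately show ?thesis by simp
    qed
    show "S s y \<ge> 0" if "0 \<le> s" "s \<le> T" for s y
      using uP[OF that, of y] vP[OF that, of y] by (simp add: S_def)
    show "continuous_on ({..T} \<times> - {0}) (\<lambda>p. G (fst p) (snd p))"
      unfolding G_def
      by (rule continuous_on_compose2[OF continuous_on_soft_pos[of UNIV]])
        (auto intro!: continuous_intros continuous_on_subset[OF w_cont])
    show "G s y \<ge> 0" for s y by (simp add: G_def soft_pos_bounds)
    show "G s y \<le> S s y" if s: "0 \<le> s" "s \<le> T" for s y
    proof -
      \<comment> \<open>\<open>u - v \<le> 2 * P - u - v\<close> amounts to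
        \<open>u \<le> P\<close>; nonnegativity of the right side uses \<open>v \<le> P\<close> as
        well.\<close>
      have "max (w s y - \<delta>) 0 \<le> S s y"
        using uP[OF s, of y] vP[OF s, of y] s(1) \<delta> by (simp add: S_def w_def)
      then show ?thesis unfolding G_def using soft_pos_bounds(2)[of "w s y - \<delta>"] by (rule order_trans[rotated])
    qed
    show "G s y = 0" if "s \<le> 0" for s y
      using w0[of s y] that \<delta> by (simp add: G_def soft_pos_def)
    show "G s y = 0" if "s \<le> T" "norm y \<le> r0" for s y
    proof -
      have "w s y \<le> \<delta>" using r0(2)[of s y] w0[of s y] that \<delta> by (cases "s \<ge> 0") auto
      then show ?thesis by (simp add: G_def soft_pos_def)
    qed
    show "r0 > 0" by (rule r0(1))
    show "t \<le> T / 2" by (simp add: T_def)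
    show "subcal (heat_coeff a) G s y" if s: "s \<le> T" and y: "y \<noteq> 0" for s y
    proof (cases "s > 0")
      case True
      obtain \<gamma>1 l1 where 1: "((\<lambda>s. u s y) has_real_derivative heat_coeff a y * l1) (at s)" "has_lap (u s) \<gamma>1 l1 y"
        using a_heat_solution_at[OF u True y] by blast
      obtain \<gamma>2 l2 where 2: "((\<lambda>s. v s y) has_real_derivative heat_coeff a y * l2) (at s)" "has_lap (v s) \<gamma>2 l2 y"
        using a_heat_solution_at[OF v True y] by blast
      define z where "z = u s y - v s y - \<delta>"
      have "((\<lambda>s. u s y - v s y - \<delta>) has_real_derivative heat_coeff a y * (l1 - l2)) (at s)"
        using 1(1) 2(1) by (auto intro!: derivative_eq_intros simp: right_diff_distrib)
      from DERIV_chain2[where f=soft_pos, OF DERIV_soft_pos this]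
      have "((\<lambda>s. soft_pos (u s y - v s y - \<delta>)) has_real_derivative soft_pos' z * (heat_coeff a y * (l1 - l2))) (at s)"
        by (simp add: z_def)
      then have "((\<lambda>s. G s y) has_real_derivative soft_pos' z * (heat_coeff a y * (l1 - l2))) (at s)"
        by (rule has_field_derivative_transform_within_open[of _ _ _ "{0<..}"]) (use True in \<open>auto simp: G_def w_def\<close>)
      moreover
      have "has_lap (\<lambda>x. u s x + (-1 * v s x + - \<delta>)) (\<gamma>1 + (-1 *\<^sub>R \<gamma>2 + 0)) (l1 + (-1 * l2 + 0)) y"
        by (intro has_lap_add has_lap_cmult has_lap_const 1 2)
      note lap = has_lap_chain[OF this DERIV_soft_pos DERIV_soft_pos']
      have eqs: "u s y + (-1 * v s y + - \<delta>) = z" "\<gamma>1 + (-1 *\<^sub>R \<gamma>2 + 0) = \<gamma>1 - \<gamma>2" "l1 + (-1 * l2 + 0) = l1 - l2"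
        by (simp_all add: z_def)
      from lap[unfolded eqs] obtain \<gamma> where "has_lap (\<lambda>x. soft_pos (u s x + (-1 * v s x + - \<delta>))) \<gamma>
          (soft_pos'' z * ((\<gamma>1 - \<gamma>2) \<bullet> (\<gamma>1 - \<gamma>2)) + soft_pos' z * (l1 - l2)) y"
        by blast
      moreover have "(\<lambda>x. soft_pos (u s x + (-1 * v s x + - \<delta>))) = G s"
        using True by (simp add: G_def w_def fun_eq_iff add_diff_eq)
      \<comment> \<open>Convexity of \<open>soft_pos\<close> gives the gradient term the favourable
        sign.\<close>
      moreover have "soft_pos' z * (heat_coeff a y * (l1 - l2)) \<le>
          heat_coeff a y * (soft_pos'' z * ((\<gamma>1 - \<gamma>2) \<bullet> (\<gamma>1 - \<gamma>2)) + soft_pos' z * (l1 - l2))"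
        using heat_coeff_nonneg[OF a(1), of y] soft_pos''_nonneg[of z] by (simp add: distrib_left mult_ac)
      ultimately show ?thesis unfolding subcal_def by metis
    next
      case False
      then have s0: "s \<le> 0" by simp
      have "continuous_on UNIV (\<lambda>s. w s y)"
        using continuous_on_compose2[OF w_cont, of UNIV "\<lambda>s. (s, y)"] by (simp add: continuous_intros)
      \<comment> \<open>This open set of times contains \<open>s\<close> and, for
        \<open>s = 0\<close>, also some positive times; \<open>G\<close> vanishes on it, which
        yields a two-sided derivative.\<close>
      then have "open {s. w s y < \<delta>}" by (intro open_Collect_less continuous_intros)
      then have "((\<lambda>s. G s y) has_real_derivative 0) (at s)"
        by (intro has_field_derivative_transform_within_open[OF DERIV_const[of 0], where S="{s. w s y < \<delta>}"])
          (use w0[of s y] s0 \<delta> in \<open>auto simp: G_def soft_pos_def\<close>)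
      moreover have "G s = (\<lambda>_. 0)"
        using w0 s0 \<delta> by (auto simp: G_def soft_pos_def)
      ultimately show ?thesis unfolding subcal_def using has_lap_const[of 0 y] by (metis mult_zero_right order_refl)
    qed
  qed
  then have "w t x - \<delta> \<le> 0" using soft_pos_pos[of "w t x - \<delta>"] by (force simp: G_def)
  then show "u t x \<le> v t x + \<delta>" using t by (simp add: w_def)
qed

theorem corollary4p25:
  fixes a :: real and u v :: "real \<Rightarrow> real ^ 'n \<Rightarrow> real"
  assumes "a > max 0 (2 - real CARD('n))"
    and "a_heat_solution a u"
    and "a_heat_solution a v"
    and "\<And>x. u 0 x = v 0 x"
    and "\<And>t. t \<ge> 0 \<Longrightarrow> u t 0 = v t 0"
  shows "\<forall>t\<ge>0. \<forall>x. u t x = v t x"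
proof (intro allI impI)
  fix t :: real and x :: "real ^ 'n" assume "t \<ge> 0"
  have a: "a > 0" "a + real CARD('n) - 2 > 0" using assms(1) by auto
  show "u t x = v t x"
  proof (cases "t = 0")
    case False
    with \<open>t \<ge> 0\<close> have t: "t > 0" by simp
    show ?thesis
      by (intro antisym a_heat_solution_le[OF a assms(2,3) _ _ t] a_heat_solution_le[OF a assms(3,2) _ _ t])
        (simp_all add: assms(4,5))
  qed (simp add: assms(4))
qed

end
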